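(* Let $\mathbf a\in\mathfrak a^+$ and $R>0$. There is a function $\Psi_R:\mathbb N\to\mathbb R$ such that, for every $\epsilon>0$, as $T\to\infty$, $$N_R(T,A)=\Psi_R(T)+O\left(\Psi_R(T)^{\frac12}\log^{2+\epsilon}(\Psi_R(T))\right)$$ for $\lambda^{mn}$-almost every $A\in\mathrm{Mat}_{m\times n}(\mathbf K)$.
   Context: Let $\mathbb F_q$ be the finite field of order $q$, $\mathbf K=\mathbb F_q((t^{-1}))$ with absolute value $|f|=q^{\deg f}$, and $\mathbf Z=\mathbb F_q[t]$. Let $\lambda$ be a Haar measure on $\mathbf K$ and $\lambda^{mn}$ the product measure on $\mathrm{Mat}_{m\times n}(\mathbf K)\simeq\mathbf K^{mn}$. Let $m,n\in\mathbb N$ (positive integers), $d=m+n$, and let $\mathfrak a^+$ be the set of $\mathbf a=(a_1,\dots,a_d)\in\mathbb N^d$ with $\sum_{i=1}^m a_i=\sum_{j=1}^n a_{m+j}$. Given $\mathbf a\in\mathfrak a^+$ define weighted quasi-norms $\|\mathbf x\|_\alpha=\max_{1\le i\le m}|x_i|^{1/a_i}$ for $\mathbf x\in\mathbf K^m$ and $\|\mathbf y\|_\beta=\max_{1\le j\le n}|y_j|^{1/a_{m+j}}$ for $\mathbf y\in\mathbf K^n$. $N_R(T,A)$ denotes the number of nonzero vectors $(\mathbf p,\mathbf q)\in\mathbf Z^m\times\mathbf Z^n$ satisfying $$\|A\mathbf q-\mathbf p\|_\alpha<\frac{q^R}{\|\mathbf q\|_\beta},\qquad 1\le\|\mathbf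 q\|_\beta\le q^T.$$ The implied constant may depend on $A$, $\epsilon$, $R$, $\mathbf a$. *)

theory Defs
  imports
    "HOL-Analysis.Analysis"
    "HOL-Computational_Algebra.Formal_Laurent_Series"
    "HOL-Library.Landau_Symbols"
begin

unbundle no fps_syntax

text \<open>
  The field of Laurent series in \<open>1/t\<close> over the finite field \<open>'a\<close> is the type \<open>'a fls\<close>, whose
  formal variable \<^const>\<open>fls_X\<close> plays the role of \<open>1/t\<close>; thus \<open>t\<close> is \<^const>\<open>fls_X_inv\<close> and
  \<open>deg f = - fls_subdegree f\<close>. The library metric on \<open>'a fls\<close> uses base 2 instead of the order
  of \<open>'a\<close>, which gives the same topology and Borel sets as the absolute value below.
\<close>

definition fls_abs :: "'a::{field,finite} fls \<Rightarrow> real" where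
  "fls_abs f = (if f = 0 then 0 else real CARD('a) powi (- fls_subdegree f))"

text \<open>The polynomials in \<open>t\<close>, as a subring of the Laurent series.\<close>

definition fls_polys :: "'a::field fls set" where
  "fls_polys = range (\<lambda>p :: 'a poly. poly (map_poly fls_const p) fls_X_inv)"

text \<open>
  On a second countable locally compact group, such as \<open>'a fls\<close> for finite \<open>'a\<close>, regularity of
  the measure follows from finiteness on compact sets and need not be demanded.
\<close>

definition haar_measure :: "'g::{t2_space,ab_group_add} measure \<Rightarrow> bool" where
  "haar_measure M \<longleftrightarrow>
     sets M = sets borel \<and>
     (\<forall>x. \<forall>S\<in>sets borel. emeasure M ((\<lambda>y. x + y) ` S) = emeasure M S) \<and>
     (\<forall>K. compact K \<longrightarrow> emeasure M K < \<infinity>) \<and>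
     (\<forall>U. open U \<longrightarrow> U \<noteq> {} \<longrightarrow> emeasure M U > 0)"

text \<open>
  The coordinates \<open>1, \<dots>, m\<close> of a weight vector are indexed by \<open>Inl i\<close> with \<open>i :: 'm\<close>, and the
  coordinates \<open>m + 1, \<dots>, m + n\<close> by \<open>Inr j\<close> with \<open>j :: 'n\<close>.
\<close>

definition weights :: "('m::finite + 'n::finite \<Rightarrow> nat) set" where
  "weights = {a. (\<forall>k. 0 < a k) \<and> (\<Sum>i\<in>UNIV. a (Inl i)) = (\<Sum>j\<in>UNIV. a (Inr j))}"

definition norm_alpha ::
  "('m::finite + 'n::finite \<Rightarrow> nat) \<Rightarrow> 'a::{field,finite} fls ^ 'm \<Rightarrow> real" where
  "norm_alpha a x = Max (range (\<lambda>i. fls_abs (x $ i) powr (1 / real (a (Inl i)))))"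

definition norm_beta ::
  "('m::finite + 'n::finite \<Rightarrow> nat) \<Rightarrow> 'a::{field,finite} fls ^ 'n \<Rightarrow> real" where
  "norm_beta a y = Max (range (\<lambda>j. fls_abs (y $ j) powr (1 / real (a (Inr j)))))"

definition approx_solutions ::
  "('m::finite + 'n::finite \<Rightarrow> nat) \<Rightarrow> real \<Rightarrow> nat \<Rightarrow> 'a::{field,finite} fls ^ 'n ^ 'm \<Rightarrow>
   (('a fls ^ 'm) \<times> ('a fls ^ 'n)) set" where
  "approx_solutions a R T A =
     {(p, q). (\<forall>i. p $ i \<in> fls_polys) \<and> (\<forall>j. q $ j \<in> fls_polys) \<and> (p, q) \<noteq> (0, 0) \<and>
        norm_alpha a (A *v q - p) < real CARD('a) powr R / norm_beta a q \<and>
        1 \<le> norm_beta a q \<and> norm_beta a q \<le> real CARD('a) ^ T}"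

definition approx_count ::
  "('m::finite + 'n::finite \<Rightarrow> nat) \<Rightarrow> real \<Rightarrow> nat \<Rightarrow> 'a::{field,finite} fls ^ 'n ^ 'm \<Rightarrow> nat" where
  "approx_count a R T A = card (approx_solutions a R T A)"

end

theory Submission
  imports Defs "HOL-Probability.Probability"
begin

text \<open>
  Let \<open>Q\<close> be the order of the finite field, \<open>size q\<close> the logarithm to base \<open>Q\<close> of the weighted norm
  of a denominator \<open>q\<close>, and \<open>D\<close> the common sum of the weights. If \<open>size q > R\<close>, then at most one
  numerator \<open>p\<close> solves the inequality, and it exists iff for every row \<open>i\<close> the first
  \<open>K q i = \<lfloor>a\<^sub>i (size q - R)\<rfloor>\<close> coefficients of the fractional part of \<open>A\<^sub>i \<cdot> q\<close> vanish. Call this event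
  \<open>hits q\<close>. The finitely many solutions with \<open>size q \<le> R\<close> only add a constant, so the count is the
  number of \<open>q\<close> with \<open>R < size q \<le> T\<close> and \<open>A \<in> hits q\<close>. For \<open>A\<close> uniform in the unit cube, \<open>hits q\<close> is
  given by independent linear conditions and has probability \<open>density q = Q\<^sup>-\<^sup>K\<close>, where \<open>K\<close> is the sum
  of the \<open>K q i\<close>. The main term \<open>\<Psi>(T)\<close> is the sum of these probabilities. About \<open>Q\<^sup>D\<^sup>s\<close> denominators
  have size \<open>s\<close> and each has density about \<open>Q\<^sup>-\<^sup>D\<^sup>s\<close>, so \<open>\<Psi>(T)\<close> is comparable to \<open>T\<close>
  (\<open>main_term_lower\<close>, \<open>main_term_upper\<close>).

  The error term comes from a second moment. If \<open>q\<close> and \<open>q'\<close> are linearly independent over the field,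
  then \<open>A \<mapsto> (A q, A q')\<close> is onto and the two events are independent. If they are proportional, write
  \<open>q = u w\<close> and \<open>q' = v w\<close> with \<open>u\<close>, \<open>v\<close> coprime and \<open>deg u \<le> deg v\<close>. An ultrametric argument leaves
  two cases: the events are still independent (\<open>jointly_onto_proportional\<close>), or in some row both
  approximations are multiples of one approximation with denominator \<open>w\<close>
  (\<open>common_approximation\<close>), which has probability \<open>density q' / Q\<^sup>V\<close> with \<open>V = deg v\<close>. There are
  about \<open>Q\<^sup>V\<close> possible \<open>u\<close>, so each degree \<open>V\<close> contributes \<open>O(T)\<close> to the variance. Summed over all
  \<open>V\<close> this is too much, as one exceptionally good approximation produces many solutions.

  The remedy is a truncation: a solution is dropped if in some row it is divisible by a polynomial of
  degree at least \<open>L\<close>. For \<open>T \<le> 2\<^sup>k\<close> take \<open>L = 2 k\<close>. Then the expected number of dropped solutions is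
  \<open>O(2\<^sup>-\<^sup>k)\<close>, hence almost surely bounded in \<open>k\<close>, while the covariances of the remaining ones add up to
  \<open>O(k 2\<^sup>k)\<close> (\<open>sum_cov\<close>). The dyadic maximal inequality of Rademacher and Menshov
  (\<open>partial_sum_le_dyadic\<close>, \<open>dyadic_expectation\<close>) turns this into a bound for all \<open>T \<le> 2\<^sup>k\<close> at once,
  and summation over \<open>k\<close> gives the error \<open>2\<^sup>k\<^sup>/\<^sup>2 k\<^sup>2\<^sup>+\<^sup>\<epsilon>\<close> almost surely (\<open>AE_discrepancy_cube\<close>). The
  count is invariant under adding polynomial matrices to \<open>A\<close>, and the polynomial translates of the
  unit cube cover the space, so the bound holds almost everywhere.
\<close>

no_notation fps_nth (infixl "$" 75)
notation fls_nth (infixl "$$" 75)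

section \<open>Polynomials and balls in the field of Laurent series\<close>

text \<open>
  The ball of all \<open>x\<close> with \<open>fls_abs x < CARD('a) powi (- k)\<close>; stated through coefficients it makes
  sense without reference to an absolute value.
\<close>

definition fls_ball :: "int \<Rightarrow> 'a::zero fls set" where
  "fls_ball k = {x. \<forall>n\<le>k. x $$ n = 0}"

lemma fls_ball_iff: "x \<in> fls_ball k \<longleftrightarrow> x = 0 \<or> k < fls_subdegree x"
proof
  assume *: "x \<in> fls_ball k"
  show "x = 0 \<or> k < fls_subdegree x"
  proof (rule ccontr)
    assume "\<not> ?thesis"
    hence "x \<noteq> 0" "fls_subdegree x \<le> k" by auto
    with * show False by (auto simp: fls_ball_def)
  qed
qed (auto simp: fls_ball_def)

lemma fls_ball_0 [simp]: "0 \<in> fls_ball k"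
  by (simp add: fls_ball_def)

lemma fls_ball_add:
  "x \<in> fls_ball k \<Longrightarrow> y \<in> fls_ball k \<Longrightarrow> (x + y :: 'a::ab_group_add fls) \<in> fls_ball k"
  by (simp add: fls_ball_def)

lemma fls_ball_diff:
  "x \<in> fls_ball k \<Longrightarrow> y \<in> fls_ball k \<Longrightarrow> (x - y :: 'a::ab_group_add fls) \<in> fls_ball k"
  by (simp add: fls_ball_def)

lemma fls_ball_mono: "l \<le> k \<Longrightarrow> x \<in> fls_ball k \<Longrightarrow> x \<in> fls_ball l"
  by (simp add: fls_ball_def)

lemma fls_ball_mult_cancel:
  fixes v :: "'a::field fls"
  assumes "v \<noteq> 0"
  shows "v * x \<in> fls_ball k \<longleftrightarrow> x \<in> fls_ball (k - fls_subdegree v)"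
  using assms by (cases "x = 0") (auto simp: fls_ball_iff)

lemma fls_ball_mult:
  fixes u :: "'a::field fls"
  assumes "u \<in> fls_ball k" "x \<in> fls_ball l"
  shows "u * x \<in> fls_ball (k + l + 1)"
  using assms by (cases "u = 0"; cases "x = 0") (auto simp: fls_ball_iff)

lemma fls_nth_poly_X_inv:
  fixes p :: "'a::field poly"
  shows "poly (map_poly fls_const p) fls_X_inv $$ n = (if n \<le> 0 then coeff p (nat (- n)) else 0)"
proof (induction p arbitrary: n)
  case 0
  then show ?case by simp
next
  case (pCons c p)
  have "poly (map_poly fls_const (pCons c p)) fls_X_inv $$ n
      = (if n = 0 then c else 0) + poly (map_poly fls_const p) fls_X_inv $$ (n + 1)"
    using pCons(1) by (simp add: map_poly_pCons fls_X_inv_times_conv_shift)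
  also have "\<dots> = (if n \<le> 0 then coeff (pCons c p) (nat (- n)) else 0)"
    unfolding pCons.IH
    by (auto simp: coeff_pCons nat_eq_iff split: nat.splits intro!: arg_cong[of _ _ "coeff p"])
  finally show ?case .
qed

lemma fls_polys_iff: "(x :: 'a::field fls) \<in> fls_polys \<longleftrightarrow> (\<forall>n>0. x $$ n = 0)"
proof
  assume "x \<in> fls_polys"
  then show "\<forall>n>0. x $$ n = 0" by (auto simp: fls_polys_def fls_nth_poly_X_inv)
next
  assume *: "\<forall>n>0. x $$ n = 0"
  define p where "p = Abs_poly (\<lambda>i. x $$ (- int i))"
  have "\<forall>\<^sub>\<infinity>i. x $$ (- int i) = 0" by simp
  hence "coeff p i = x $$ (- int i)" for i
    unfolding p_def by (subst Abs_poly_inverse) auto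
  hence "x = poly (map_poly fls_const p) fls_X_inv"
    using * by (intro fls_eqI) (auto simp: fls_nth_poly_X_inv)
  thus "x \<in> fls_polys" by (auto simp: fls_polys_def)
qed

lemma fls_polys_0 [simp]: "(0 :: 'a::field fls) \<in> fls_polys"
  and fls_polys_1 [simp]: "(1 :: 'a::field fls) \<in> fls_polys"
  by (auto simp: fls_polys_iff)

lemma fls_polys_add: "x \<in> fls_polys \<Longrightarrow> y \<in> fls_polys \<Longrightarrow> (x + y :: 'a::field fls) \<in> fls_polys"
  by (simp add: fls_polys_iff)

lemma fls_polys_diff: "x \<in> fls_polys \<Longrightarrow> y \<in> fls_polys \<Longrightarrow> (x - y :: 'a::field fls) \<in> fls_polys"
  by (simp add: fls_polys_iff)

lemma fls_polys_uminus: "x \<in> fls_polys \<Longrightarrow> (- x :: 'a::field fls) \<in> fls_polys"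
  by (simp add: fls_polys_iff)

lemma fls_polys_sum:
  "(\<And>i. i \<in> I \<Longrightarrow> f i \<in> fls_polys) \<Longrightarrow> (\<Sum>i\<in>I. f i :: 'a::field fls) \<in> fls_polys"
  by (induction I rule: infinite_finite_induct) (auto intro: fls_polys_add)

lemma fls_polys_mult:
  assumes "x \<in> fls_polys" "y \<in> fls_polys"
  shows "(x * y :: 'a::field fls) \<in> fls_polys"
  unfolding fls_polys_iff
proof (intro allI impI)
  fix n :: int assume n: "n > 0"
  have "x $$ i * y $$ (n - i) = 0" for i
    using assms n by (cases "i > 0") (auto simp: fls_polys_iff)
  thus "(x * y) $$ n = 0" by (subst fls_times_nth(2)) (auto intro!: sum.neutral)
qed

lemma fls_subdegree_poly_nonpos: "(x :: 'a::field fls) \<in> fls_polys \<Longrightarrow> fls_subdegree x \<le> 0"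
  by (cases "x = 0") (auto simp: fls_polys_iff intro: fls_subdegree_leI' dest: nth_fls_subdegree_nonzero
     intro!: leI)

lemma fls_polys_ball_0: "(x :: 'a::field fls) \<in> fls_polys \<Longrightarrow> x \<in> fls_ball 0 \<Longrightarrow> x = 0"
  using fls_subdegree_poly_nonpos[of x] by (auto simp: fls_ball_iff)

definition poly_part :: "'a::field fls \<Rightarrow> 'a fls" where
  "poly_part x = Abs_fls (\<lambda>n. if n \<le> 0 then x $$ n else 0)"

lemma poly_part_nth: "poly_part x $$ n = (if n \<le> 0 then x $$ n else 0)"
  unfolding poly_part_def
  by (subst nth_Abs_fls_lower_bound[of "fls_subdegree x"]) auto

lemma poly_part_in_polys [simp]: "poly_part x \<in> fls_polys"
  by (simp add: fls_polys_iff poly_part_nth)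

lemma minus_poly_part [simp]: "x - poly_part x \<in> fls_ball 0"
  by (simp add: fls_ball_def poly_part_nth)

text \<open>
  Euclid's algorithm: the polynomial part of \<open>x / y\<close> is the quotient, and the remainder has smaller
  degree than \<open>y\<close>. Coprimality is recorded as a Bezout identity, the form in which it is used.
\<close>

lemma reduced_fraction:
  fixes x y :: "'a::field fls"
  assumes "x \<in> fls_polys" "y \<in> fls_polys" "y \<noteq> 0"
  shows "\<exists>u\<in>fls_polys. \<exists>v\<in>fls_polys. \<exists>\<alpha>\<in>fls_polys. \<exists>\<beta>\<in>fls_polys.
           v \<noteq> 0 \<and> x * v = u * y \<and> \<alpha> * u + \<beta> * v = 1"
  using assms
proof (induction "nat (- fls_subdegree y)" arbitrary: x y rule: less_induct)
  case less
  define h where "h = poly_part (x / y)"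
  define r where "r = x - y * h"
  have h: "h \<in> fls_polys" by (simp add: h_def)
  have r: "r \<in> fls_polys" using less.prems h by (auto simp: r_def intro!: fls_polys_diff fls_polys_mult)
  have "r = y * (x / y - h)" using less.prems by (simp add: r_def right_diff_distrib)
  moreover have "y * (x / y - h) \<in> fls_ball (fls_subdegree y)"
    using less.prems minus_poly_part[of "x / y"] by (subst fls_ball_mult_cancel) (auto simp: h_def)
  ultimately have rb: "r \<in> fls_ball (fls_subdegree y)" by simp
  show ?case
  proof (cases "r = 0")
    case True
    hence "x * 1 = h * y" by (simp add: r_def mult.commute)
    moreover have "0 * h + 1 * 1 = (1 :: 'a fls)" by simp
    ultimately show ?thesis using h by (metis fls_polys_0 fls_polys_1 zero_neq_one)
  next
    case False
    with rb fls_subdegree_poly_nonpos[OF r] have "nat (- fls_subdegree r) < nat (- fls_subdegree y)"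
      by (auto simp: fls_ball_iff)
    from less.hyps[OF this less.prems(2) r False] obtain u v \<alpha> \<beta> where uv:
      "u \<in> fls_polys" "v \<in> fls_polys" "\<alpha> \<in> fls_polys" "\<beta> \<in> fls_polys"
      "v \<noteq> 0" "y * v = u * r" "\<alpha> * u + \<beta> * v = 1" by blast
    have "u \<noteq> 0" using uv less.prems by auto
    moreover have "x * u = (h * u + v) * y"
    proof -
      have "x = y * h + r" by (simp add: r_def)
      hence "x * u = y * h * u + u * r" by (simp add: algebra_simps)
      thus ?thesis using uv(6) by (simp add: algebra_simps)
    qed
    moreover have "\<beta> * (h * u + v) + (\<alpha> - h * \<beta>) * u = 1"
      using uv(7) by (simp add: algebra_simps)
    ultimately show ?thesis using uv h
      by (intro bexI[of _ "h * u + v"] bexI[of _ u] bexI[of _ \<beta>] bexI[of _ "\<alpha> - h * \<beta>"])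
         (auto intro!: fls_polys_diff fls_polys_mult fls_polys_add)
  qed
qed

abbreviation poly_vecs :: "('a::field fls ^ 'n) set" where
  "poly_vecs \<equiv> {q. \<forall>j. q $ j \<in> fls_polys}"

text \<open>
  Vanishing of all \<open>2 \<times> 2\<close> minors means proportionality over the field. With the ratio \<open>u / v\<close> in lowest
  terms, \<open>\<alpha> q + \<beta> q'\<close> is the common vector.
\<close>

lemma proportional_poly_vecs:
  fixes q q' :: "'a::field fls ^ 'n"
  assumes q: "q \<in> poly_vecs" "q' \<in> poly_vecs" "q \<noteq> 0"
    and cross: "\<And>i j. q $ i * q' $ j = q $ j * q' $ i" and "q' \<noteq> 0"
  obtains u v \<alpha> \<beta> w where "u \<in> fls_polys" "v \<in> fls_polys" "\<alpha> \<in> fls_polys" "\<beta> \<in> fls_polys"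
    "w \<in> poly_vecs" "u \<noteq> 0" "v \<noteq> 0" "\<alpha> * u + \<beta> * v = 1"
    "\<And>j. q $ j = u * w $ j" "\<And>j. q' $ j = v * w $ j"
proof -
  obtain j0 where j0: "q' $ j0 \<noteq> 0" using \<open>q' \<noteq> 0\<close> by (auto simp: vec_eq_iff)
  obtain u v \<alpha> \<beta> where uv: "u \<in> fls_polys" "v \<in> fls_polys" "\<alpha> \<in> fls_polys" "\<beta> \<in> fls_polys"
      "v \<noteq> 0" "q $ j0 * v = u * q' $ j0" "\<alpha> * u + \<beta> * v = 1"
    using reduced_fraction[of "q $ j0" "q' $ j0"] q j0 by auto
  have vq: "v * q $ j = u * q' $ j" for j
  proof -
    have "q' $ j0 * (v * q $ j) = v * (q $ j * q' $ j0)" by (simp add: mult_ac)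
    also have "\<dots> = (q $ j0 * v) * q' $ j" unfolding cross[of j j0] by (simp only: mult_ac)
    also have "\<dots> = q' $ j0 * (u * q' $ j)" unfolding uv(6) by (simp only: mult_ac)
    finally show ?thesis using j0 by simp
  qed
  define w :: "'a fls ^ 'n" where "w = (\<chi> j. \<alpha> * q $ j + \<beta> * q' $ j)"
  have "q $ j = u * w $ j" for j
  proof -
    have "u * w $ j = \<alpha> * u * q $ j + \<beta> * (u * q' $ j)" by (simp add: w_def algebra_simps)
    also have "\<dots> = (\<alpha> * u + \<beta> * v) * q $ j" by (simp add: vq[symmetric] algebra_simps)
    finally show ?thesis using uv by simp
  qed
  moreover have "q' $ j = v * w $ j" for j
  proof -
    have "v * w $ j = \<alpha> * (v * q $ j) + \<beta> * v * q' $ j" by (simp add: w_def algebra_simps)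
    also have "\<dots> = (\<alpha> * u + \<beta> * v) * q' $ j" by (simp add: vq algebra_simps)
    finally show ?thesis using uv by simp
  qed
  moreover have "u \<noteq> 0" using vq \<open>q \<noteq> 0\<close> uv(5) by (auto simp: vec_eq_iff)
  moreover have "w \<in> poly_vecs" using uv q by (auto simp: w_def intro!: fls_polys_add fls_polys_mult)
  ultimately show ?thesis using that uv by blast
qed

definition polys_below :: "nat \<Rightarrow> 'a::field fls set" where
  "polys_below N = fls_polys \<inter> fls_ball (- int N)"

lemma bij_betw_polys_below:
  "bij_betw (\<lambda>x. restrict (\<lambda>i. x $$ (- int i)) {..<N}) (polys_below N :: 'a::field fls set)
     (PiE {..<N} (\<lambda>_. UNIV))"
proof (rule bij_betwI')
  fix x y :: "'a fls" assume xy: "x \<in> polys_below N" "y \<in> polys_below N"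
  show "(restrict (\<lambda>i. x $$ (- int i)) {..<N} = restrict (\<lambda>i. y $$ (- int i)) {..<N}) = (x = y)"
  proof
    assume *: "restrict (\<lambda>i. x $$ (- int i)) {..<N} = restrict (\<lambda>i. y $$ (- int i)) {..<N}"
    show "x = y"
    proof (rule fls_eqI)
      fix n :: int
      consider "n > 0" | "n \<le> - int N" | "- int N < n" "n \<le> 0" by linarith
      thus "x $$ n = y $$ n"
      proof cases
        case 3
        hence "nat (-n) < N" by auto
        with fun_cong[OF *, of "nat (-n)"] 3 show ?thesis by simp
      qed (use xy in \<open>auto simp: polys_below_def fls_polys_iff fls_ball_def\<close>)
    qed
  qed simp
next
  fix f :: "nat \<Rightarrow> 'a" assume f: "f \<in> PiE {..<N} (\<lambda>_. UNIV)"
  define x where "x = Abs_fls (\<lambda>n. if n \<le> 0 \<and> - int N < n then f (nat (- n)) else 0)"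
  have x: "x $$ n = (if n \<le> 0 \<and> - int N < n then f (nat (- n)) else 0)" for n
    unfolding x_def by (subst nth_Abs_fls_lower_bound[of "- int N"]) auto
  have "x \<in> polys_below N" by (auto simp: polys_below_def fls_polys_iff fls_ball_def x)
  moreover have "f = restrict (\<lambda>i. x $$ (- int i)) {..<N}"
    using f by (auto simp: fun_eq_iff x PiE_def extensional_def)
  ultimately show "\<exists>x\<in>polys_below N. f = restrict (\<lambda>i. x $$ (- int i)) {..<N}" by blast
qed auto

lemma finite_polys_below [simp]: "finite (polys_below N :: 'a::{field,finite} fls set)"
  using bij_betw_finite[OF bij_betw_polys_below[where 'a='a and N=N]] by (simp add: finite_PiE)

lemma card_polys_below: "card (polys_below N :: 'a::{field,finite} fls set) = CARD('a) ^ N"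
  using bij_betw_same_card[OF bij_betw_polys_below[where 'a='a and N=N]] by (simp add: card_PiE)

lemma countable_fls_polys: "countable (fls_polys :: 'a::{field,finite} fls set)"
proof -
  have "(fls_polys :: 'a fls set) \<subseteq> (\<Union>N. polys_below N)"
  proof
    fix x :: "'a fls" assume x: "x \<in> fls_polys"
    have "x \<in> polys_below (Suc (nat (- fls_subdegree x)))"
      using x by (auto simp: polys_below_def fls_ball_iff)
    thus "x \<in> (\<Union>N. polys_below N)" by blast
  qed
  moreover have "countable (\<Union>N. polys_below N :: 'a fls set)"
    by (intro countable_UN) (auto intro: countable_finite)
  ultimately show ?thesis by (rule countable_subset)
qed

section \<open>Topology of the field and the uniform measure on the unit cube\<close>

lemma open_fls_iff:
  fixes S :: "'a::ab_group_add fls set"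
  shows "open S \<longleftrightarrow> (\<forall>x\<in>S. \<exists>k. \<forall>y. y - x \<in> fls_ball k \<longrightarrow> y \<in> S)"
proof
  assume S: "open S"
  show "\<forall>x\<in>S. \<exists>k. \<forall>y. y - x \<in> fls_ball k \<longrightarrow> y \<in> S"
  proof
    fix x assume "x \<in> S"
    with S obtain r where r: "r > 0" "\<And>y. dist y x < r \<Longrightarrow> y \<in> S"
      unfolding open_dist by blast
    obtain k :: nat where k: "(1 / 2) ^ k < r" using real_arch_pow_inv[of r "1/2"] r by auto
    have "y \<in> S" if "y - x \<in> fls_ball (int k)" for y
    proof (cases "y = x")
      case False
      with that have "int k < fls_subdegree (y - x)" by (auto simp: fls_ball_iff)
      hence "dist y x \<le> (1 / 2) ^ k"
        using False by (auto simp: dist_fls_def power_one_over field_simps intro!: power_increasing)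
      thus ?thesis using k r by auto
    qed (use \<open>x \<in> S\<close> in simp)
    thus "\<exists>k. \<forall>y. y - x \<in> fls_ball k \<longrightarrow> y \<in> S" by blast
  qed
next
  assume *: "\<forall>x\<in>S. \<exists>k. \<forall>y. y - x \<in> fls_ball k \<longrightarrow> y \<in> S"
  show "open S"
    unfolding open_dist
  proof
    fix x assume "x \<in> S"
    with * obtain k where k: "\<And>y. y - x \<in> fls_ball k \<Longrightarrow> y \<in> S" by blast
    have "y \<in> S" if "dist y x < (1 / 2) ^ nat k" for y
    proof (cases "y = x")
      case False
      have "k < fls_subdegree (y - x)"
      proof (cases "fls_subdegree (y - x) \<ge> 0")
        case True
        with that False have "(2 :: real) ^ nat k < 2 ^ nat (fls_subdegree (y - x))"
          by (simp add: dist_fls_def power_one_over inverse_eq_divide field_simps)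
        hence "nat k < nat (fls_subdegree (y - x))" by (simp add: power_strict_increasing_iff)
        thus ?thesis by simp
      next
        case neg: False
        have "(1 / 2 :: real) ^ nat k \<le> 1" by (simp add: power_le_one)
        also have "\<dots> \<le> dist y x" using neg False by (simp add: dist_fls_def)
        finally show ?thesis using that by simp
      qed
      thus ?thesis using k[of y] by (simp add: fls_ball_iff)
    qed (use \<open>x \<in> S\<close> in simp)
    thus "\<exists>e>0. \<forall>y. dist y x < e \<longrightarrow> y \<in> S" by (intro exI[of _ "(1 / 2) ^ nat k"]) auto
  qed
qed

lemma open_fls_ball: "open (fls_ball k :: 'a::ab_group_add fls set)"
  unfolding open_fls_iff
proof
  fix x :: "'a fls" assume x: "x \<in> fls_ball k"
  have "y \<in> fls_ball k" if "y - x \<in> fls_ball k" for y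
    using fls_ball_add[OF that x] by simp
  thus "\<exists>k'. \<forall>y. y - x \<in> fls_ball k' \<longrightarrow> y \<in> fls_ball k" by blast
qed

text \<open>
  The unit ball is a continuous image of the Cantor space of coefficient sequences, which is compact by
  Tychonoff's theorem. Hence a Haar measure is finite on it.
\<close>

lemma compact_fls_ball_0: "compact (fls_ball 0 :: 'a::{field,finite} fls set)"
proof -
  define X :: "(nat \<Rightarrow> 'a) topology" where "X = product_topology (\<lambda>_. discrete_topology UNIV) UNIV"
  define f :: "(nat \<Rightarrow> 'a) \<Rightarrow> 'a fls" where "f = (\<lambda>g. fls_shift (- 1) (fps_to_fls (Abs_fps g)))"
  have f: "f g $$ n = (if n \<le> 0 then 0 else g (nat (n - 1)))" for g n by (simp add: f_def)
  have top: "topspace X = UNIV" by (simp add: X_def topspace_product_topology PiE_UNIV_domain)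
  have "compact_space X" by (simp add: X_def compact_space_product_topology compact_space_discrete_topology)
  hence cX: "compactin X UNIV" by (simp add: compact_space_def top)
  have "continuous_map X euclidean f"
    unfolding continuous_map_def
  proof (intro conjI allI impI)
    fix U :: "'a fls set" assume "openin euclidean U"
    hence U: "open U" by simp
    show "openin X {x \<in> topspace X. f x \<in> U}"
    proof (subst openin_subopen, intro ballI)
      fix x assume x: "x \<in> {x \<in> topspace X. f x \<in> U}"
      obtain k where k: "\<And>y. y - f x \<in> fls_ball k \<Longrightarrow> y \<in> U"
        using x U unfolding open_fls_iff by blast
      define T where "T = PiE UNIV (\<lambda>i. if i < nat k then {x i} else UNIV)"
      have "{i. (if i < nat k then {x i} else UNIV) \<noteq> topspace (discrete_topology UNIV)} \<subseteq> {..<nat k}"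
        by auto
      hence "openin X T"
        unfolding T_def X_def
        by (intro product_topology_basis) (auto intro: finite_subset)
      moreover have "x \<in> T" by (auto simp: T_def)
      moreover have "T \<subseteq> {x \<in> topspace X. f x \<in> U}"
      proof
        fix g assume "g \<in> T"
        hence g: "g i = x i" if "i < nat k" for i using that by (auto simp: T_def PiE_iff split: if_splits)
        have "f g - f x \<in> fls_ball k"
          by (auto simp: fls_ball_def f intro!: g)
        thus "g \<in> {x \<in> topspace X. f x \<in> U}" using k top by auto
      qed
      ultimately show "\<exists>T. openin X T \<and> x \<in> T \<and> T \<subseteq> {x \<in> topspace X. f x \<in> U}" by blast
    qed
  qed auto
  hence "compactin euclidean (f ` UNIV)" using cX image_compactin by blast
  moreover have "range f = fls_ball 0"
  proof (intro equalityI subsetI)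
    fix x :: "'a fls" assume "x \<in> fls_ball 0"
    hence "x = f (\<lambda>i. x $$ (int i + 1))" by (intro fls_eqI) (auto simp: f fls_ball_def)
    thus "x \<in> range f" by blast
  qed (auto simp: f fls_ball_def)
  ultimately show ?thesis by simp
qed

lemma continuous_on_fls_translate: "continuous_on UNIV (\<lambda>y. c + y :: 'a::ab_group_add fls)"
  unfolding continuous_on_open_vimage[OF open_UNIV]
proof (intro allI impI)
  fix B :: "'a fls set" assume B: "open B"
  have "open ((\<lambda>y. c + y) -` B)"
    unfolding open_fls_iff
  proof
    fix x assume "x \<in> (\<lambda>y. c + y) -` B"
    then obtain k where k: "\<And>y. y - (c + x) \<in> fls_ball k \<Longrightarrow> y \<in> B"
      using B unfolding open_fls_iff by blast
    have "c + y \<in> B" if "y - x \<in> fls_ball k" for y using k[of "c + y"] that by simp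
    thus "\<exists>k. \<forall>y. y - x \<in> fls_ball k \<longrightarrow> y \<in> (\<lambda>y. c + y) -` B" by auto
  qed
  thus "open ((\<lambda>y. c + y) -` B \<inter> UNIV)" by simp
qed

text \<open>
  A coefficient of \<open>x * z\<close> depends on finitely many coefficients of \<open>x\<close> only, so it is locally constant.
\<close>

lemma measurable_coeff_mult:
  fixes z :: "'a::{field,finite} fls"
  shows "(\<lambda>x. (x * z) $$ n) \<in> borel \<rightarrow>\<^sub>M count_space UNIV"
proof (subst measurable_count_space_eq_countable)
  have "open ((\<lambda>x. (x * z) $$ n) -` {b})" for b
    unfolding open_fls_iff
  proof
    fix x assume x: "x \<in> (\<lambda>x. (x * z) $$ n) -` {b}"
    have z: "z \<in> fls_ball (fls_subdegree z - 1)" by (simp add: fls_ball_iff)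
    have eq: "(y * z) $$ n = (x * z) $$ n" if "y - x \<in> fls_ball (n - fls_subdegree z)" for y
    proof -
      have "(y - x) * z \<in> fls_ball n" using fls_ball_mult[OF that z] by simp
      hence "((y - x) * z) $$ n = 0" unfolding fls_ball_def by simp
      thus ?thesis by (simp add: left_diff_distrib)
    qed
    have "y \<in> (\<lambda>x. (x * z) $$ n) -` {b}" if "y - x \<in> fls_ball (n - fls_subdegree z)" for y
      using eq[OF that] x by simp
    thus "\<exists>k. \<forall>y. y - x \<in> fls_ball k \<longrightarrow> y \<in> (\<lambda>x. (x * z) $$ n) -` {b}" by blast
  qed
  thus "(\<lambda>x. (x * z) $$ n) \<in> space borel \<rightarrow> UNIV \<and>
    (\<forall>a\<in>UNIV. (\<lambda>x. (x * z) $$ n) -` {a} \<inter> space borel \<in> sets borel)" by auto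
qed auto

text \<open>
  Addition is applied after the discrete coefficient maps, which avoids measurability of addition on
  the field itself.
\<close>

lemma measurable_sum_finite_type:
  fixes f :: "'i \<Rightarrow> 'b \<Rightarrow> 'a::{comm_monoid_add,finite}"
  assumes "\<And>i. i \<in> I \<Longrightarrow> f i \<in> M \<rightarrow>\<^sub>M count_space UNIV"
  shows "(\<lambda>x. \<Sum>i\<in>I. f i x) \<in> M \<rightarrow>\<^sub>M count_space UNIV"
  using assms
proof (induction I rule: infinite_finite_induct)
  case (insert i I)
  have "(\<lambda>x. f i x + (\<Sum>i\<in>I. f i x)) \<in> M \<rightarrow>\<^sub>M count_space UNIV"
  proof (rule measurable_compose_countable[where f = "\<lambda>b x. b + (\<Sum>i\<in>I. f i x)" and g = "f i"])
    show "f i \<in> M \<rightarrow>\<^sub>M count_space UNIV" using insert by simp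
    fix b
    have "(\<lambda>x. \<Sum>i\<in>I. f i x) \<in> M \<rightarrow>\<^sub>M count_space UNIV" using insert by simp
    from measurable_compose[OF this, of "\<lambda>s. b + s" "count_space UNIV"]
    show "(\<lambda>x. b + (\<Sum>i\<in>I. f i x)) \<in> M \<rightarrow>\<^sub>M count_space UNIV" by simp
  qed
  thus ?case using insert by simp
qed auto

text \<open>
  The matrix space carries the product measure \<open>M\<close>; probabilities refer to the uniform measure \<open>P\<close> on
  the unit cube, a fundamental domain for the lattice of polynomial points.
\<close>

locale haar =
  fixes lam :: "'a::{field,finite} fls measure"
    and index :: "'k::finite itself"
  assumes haar: "haar_measure lam"
begin

definition M :: "('k \<Rightarrow> 'a fls) measure" where "M = PiM UNIV (\<lambda>_. lam)"

definition cube :: "('k \<Rightarrow> 'a fls) set" where "cube = {x. \<forall>k. x k \<in> fls_ball 0}"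

definition P :: "('k \<Rightarrow> 'a fls) measure" where "P = uniform_measure M cube"

definition lattice :: "('k \<Rightarrow> 'a fls) set" where "lattice = {c. \<forall>k. c k \<in> fls_polys}"

lemma sets_lam: "sets lam = sets borel"
  and lam_translate: "S \<in> sets borel \<Longrightarrow> emeasure lam ((\<lambda>y. x + y) ` S) = emeasure lam S"
  and lam_compact: "compact K \<Longrightarrow> emeasure lam K < \<infinity>"
  and lam_open: "open U \<Longrightarrow> U \<noteq> {} \<Longrightarrow> emeasure lam U > 0"
  using haar by (auto simp: haar_measure_def)

lemma space_lam: "space lam = UNIV"
  using sets_eq_imp_space_eq[OF sets_lam] by simp

lemma space_M [simp]: "space M = UNIV"
  by (simp add: M_def space_PiM space_lam PiE_UNIV_domain)

lemma measurable_translate: "(\<lambda>y. c + y) \<in> lam \<rightarrow>\<^sub>M lam"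
  using borel_measurable_continuous_onI[OF continuous_on_fls_translate, of c]
  by (simp cong: measurable_cong_sets add: sets_lam)

lemma lam_vimage_translate:
  assumes "S \<in> sets lam"
  shows "emeasure lam ((\<lambda>y. c + y) -` S) = emeasure lam S"
proof -
  have "(\<lambda>y. c + y) -` S = (\<lambda>y. - c + y) ` S"
  proof (intro set_eqI iffI)
    fix y assume "y \<in> (\<lambda>y. c + y) -` S"
    thus "y \<in> (\<lambda>y. - c + y) ` S" by (intro image_eqI[of _ _ "c + y"]) auto
  qed auto
  thus ?thesis using lam_translate[of S "- c"] assms by (simp add: sets_lam)
qed

sublocale sf: sigma_finite_measure lam
proof
  define F where "F = (\<lambda>c. (\<lambda>y. c + y) ` fls_ball 0) ` (fls_polys :: 'a fls set)"
  have fin: "emeasure lam ((\<lambda>y. c + y) ` fls_ball 0) \<noteq> \<infinity>" for c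
    using lam_translate[OF borel_open[OF open_fls_ball], of c 0] lam_compact[OF compact_fls_ball_0]
    by simp
  have meas: "(\<lambda>y. c + y) ` fls_ball 0 \<in> sets lam" for c
  proof -
    have "(\<lambda>y. c + y) ` fls_ball 0 = (\<lambda>y. - c + y) -` fls_ball 0 \<inter> space lam"
    proof (intro set_eqI iffI)
      fix y assume "y \<in> (\<lambda>y. - c + y) -` fls_ball 0 \<inter> space lam"
      thus "y \<in> (\<lambda>y. c + y) ` fls_ball 0" by (intro image_eqI[of _ _ "- c + y"]) auto
    qed (auto simp: space_lam)
    also have "\<dots> \<in> sets lam"
      by (rule measurable_sets[OF measurable_translate]) (simp add: sets_lam borel_open open_fls_ball)
    finally show ?thesis .
  qed
  have "\<Union>F = UNIV"
  proof -
    have "x \<in> (\<lambda>y. poly_part x + y) ` fls_ball 0" for x :: "'a fls"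
      by (rule image_eqI[of _ _ "x - poly_part x"]) auto
    thus ?thesis using poly_part_in_polys unfolding F_def by blast
  qed
  moreover have "countable F" unfolding F_def by (intro countable_image countable_fls_polys)
  ultimately show "\<exists>A. countable A \<and> A \<subseteq> sets lam \<and> \<Union> A = space lam \<and> (\<forall>a\<in>A. emeasure lam a \<noteq> \<infinity>)"
    using fin meas by (intro exI[of _ F]) (fastforce simp: F_def space_lam)
qed

sublocale pf: product_sigma_finite "\<lambda>_::'k. lam"
  by unfold_locales

lemma measurable_M_translate: "(\<lambda>x k. c k + x k) \<in> M \<rightarrow>\<^sub>M M"
  unfolding M_def
proof (rule measurable_PiM_single')
  fix k :: 'k
  show "(\<lambda>x. c k + x k) \<in> PiM UNIV (\<lambda>_. lam) \<rightarrow>\<^sub>M lam"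
    by (rule measurable_compose[of "\<lambda>x. x k", OF measurable_component_singleton measurable_translate]) auto
qed (auto simp: space_lam)

text \<open>
  A product measure is determined by its values on boxes, and a translate of a box is a box.
\<close>

lemma distr_M_translate: "distr M M (\<lambda>x k. c k + x k) = M"
proof -
  have "distr M M (\<lambda>x k. c k + x k) = PiM UNIV (\<lambda>_. lam)"
  proof (rule pf.PiM_eqI)
    fix A :: "'k \<Rightarrow> 'a fls set" assume A: "\<And>k. k \<in> UNIV \<Longrightarrow> A k \<in> sets lam"
    have "emeasure (distr M M (\<lambda>x k. c k + x k)) (PiE UNIV A)
        = emeasure M ((\<lambda>x k. c k + x k) -` PiE UNIV A \<inter> space M)"
      using A by (intro emeasure_distr measurable_M_translate) (auto simp: M_def intro!: sets_PiM_I_finite)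
    also have "(\<lambda>x k. c k + x k) -` PiE UNIV A \<inter> space M = PiE UNIV (\<lambda>k. (\<lambda>y. c k + y) -` A k)"
      by (auto simp: PiE_iff)
    also have "emeasure M \<dots> = (\<Prod>k\<in>UNIV. emeasure lam ((\<lambda>y. c k + y) -` A k))"
      unfolding M_def using A measurable_sets[OF measurable_translate]
      by (intro pf.emeasure_PiM) (auto simp: space_lam)
    also have "\<dots> = (\<Prod>k\<in>UNIV. emeasure lam (A k))"
      using A by (intro prod.cong lam_vimage_translate) auto
    finally show "emeasure (distr M M (\<lambda>x k. c k + x k)) (PiE UNIV A) = (\<Prod>k\<in>UNIV. emeasure lam (A k))" .
  qed (auto simp: M_def)
  thus ?thesis by (simp add: M_def)
qed

lemma emeasure_vimage_translate:
  assumes "S \<in> sets M" shows "emeasure M ((\<lambda>x k. c k + x k) -` S) = emeasure M S"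
  using emeasure_distr[OF measurable_M_translate assms, of c] by (simp add: distr_M_translate)

lemma cube_PiE: "cube = PiE UNIV (\<lambda>_. fls_ball 0)"
  by (auto simp: cube_def PiE_iff)

lemma sets_cube [measurable]: "cube \<in> sets M"
  unfolding cube_PiE M_def by (intro sets_PiM_I_finite) (auto simp: sets_lam borel_open open_fls_ball)

lemma emeasure_cube: "emeasure M cube = (\<Prod>k\<in>(UNIV::'k set). emeasure lam (fls_ball 0))"
  unfolding cube_PiE M_def by (rule pf.emeasure_PiM) (auto simp: sets_lam borel_open open_fls_ball)

lemma emeasure_cube_pos: "emeasure M cube \<noteq> 0"
proof -
  have "emeasure lam (fls_ball 0) > 0" by (intro lam_open open_fls_ball) (auto intro: fls_ball_0)
  thus ?thesis by (simp add: emeasure_cube)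
qed

lemma emeasure_cube_finite: "emeasure M cube \<noteq> \<infinity>"
  unfolding emeasure_cube using lam_compact[OF compact_fls_ball_0]
  by (simp add: power_eq_top_ennreal)

sublocale P: prob_space P
  unfolding P_def by (intro prob_space_uniform_measure emeasure_cube_pos emeasure_cube_finite)

lemma sets_P [simp, measurable_cong]: "sets P = sets M" and space_P [simp]: "space P = UNIV"
  by (simp_all add: P_def)

text \<open>
  Joint surjectivity makes all joint level sets of the functionals, cut down to the cube, translates of
  each other; there are \<open>CARD('a) ^ card I\<close> of them, and they partition the cube. Vanishing on the lattice
  allows translating by a point of the cube.
\<close>

lemma prob_kernel:
  fixes l :: "'i \<Rightarrow> ('k \<Rightarrow> 'a fls) \<Rightarrow> 'a"
  assumes fin: "finite I"
    and add: "\<And>i x y. i \<in> I \<Longrightarrow> l i (\<lambda>k. x k + y k) = l i x + l i y"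
    and lat: "\<And>i c. i \<in> I \<Longrightarrow> c \<in> lattice \<Longrightarrow> l i c = 0"
    and meas: "\<And>i. i \<in> I \<Longrightarrow> l i \<in> M \<rightarrow>\<^sub>M count_space UNIV"
    and surj: "\<And>f. \<exists>x. \<forall>i\<in>I. l i x = f i"
  shows "measure P {x. \<forall>i\<in>I. l i x = 0} = 1 / real CARD('a) ^ card I"
proof -
  define E where "E f = {x. \<forall>i\<in>I. l i x = f i} \<inter> cube" for f :: "'i \<Rightarrow> 'a"
  have "E f = (\<Inter>i\<in>I. l i -` {f i} \<inter> space M) \<inter> cube" for f by (auto simp: E_def)
  moreover have "(\<Inter>i\<in>I. l i -` {f i} \<inter> space M) \<inter> cube \<in> sets M" for f
    using fin meas measurable_sets[OF meas]
    by (cases "I = {}") (auto intro!: sets.Int sets.finite_INT)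
  ultimately have EM: "E f \<in> sets M" for f by simp
  define J :: "('i \<Rightarrow> 'a) set" where "J = PiE I (\<lambda>_. UNIV)"
  have finJ: "finite J" using fin by (simp add: J_def finite_PiE)
  have same: "emeasure M (E f) = emeasure M (E (\<lambda>_. 0))" for f
  proof -
    obtain x where x: "\<And>i. i \<in> I \<Longrightarrow> l i x = f i" using surj by blast
    define c where "c = (\<lambda>k. x k - poly_part (x k))"
    have c: "l i c = f i" if "i \<in> I" for i
    proof -
      have "(\<lambda>k. poly_part (x k)) \<in> lattice" by (simp add: lattice_def)
      moreover have "x = (\<lambda>k. c k + poly_part (x k))" by (simp add: c_def)
      ultimately show ?thesis using add[OF that, of c "\<lambda>k. poly_part (x k)"] lat[OF that] x[OF that] by simp
    qed
    have cc: "c k \<in> fls_ball 0" for k by (simp add: c_def)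
    have "(\<lambda>y k. c k + y k) -` E f = E (\<lambda>_. 0)"
    proof (intro set_eqI iffI)
      fix y assume y: "y \<in> (\<lambda>y k. c k + y k) -` E f"
      have "y k \<in> fls_ball 0" for k
        using fls_ball_diff[of "c k + y k" 0 "c k"] y cc[of k] by (auto simp: E_def cube_def)
      thus "y \<in> E (\<lambda>_. 0)" using y by (auto simp: E_def cube_def add c)
    next
      fix y assume "y \<in> E (\<lambda>_. 0)"
      thus "y \<in> (\<lambda>y k. c k + y k) -` E f"
        using cc by (auto simp: E_def cube_def add c intro: fls_ball_add)
    qed
    with emeasure_vimage_translate[OF EM, of c f] show ?thesis by simp
  qed
  have "cube = (\<Union>f\<in>J. E f)"
  proof (intro set_eqI iffI)
    fix x assume "x \<in> cube"
    hence "x \<in> E (restrict (\<lambda>i. l i x) I)" by (auto simp: E_def)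
    moreover have "restrict (\<lambda>i. l i x) I \<in> J" by (auto simp: J_def)
    ultimately show "x \<in> (\<Union>f\<in>J. E f)" by blast
  qed (auto simp: E_def)
  moreover have "disjoint_family_on E J"
    unfolding disjoint_family_on_def
  proof (intro ballI impI)
    fix f g assume fg: "f \<in> J" "g \<in> J" "f \<noteq> g"
    then obtain i where "i \<in> I" "f i \<noteq> g i" by (metis J_def PiE_ext)
    thus "E f \<inter> E g = {}" by (auto simp: E_def)
  qed
  ultimately have "emeasure M cube = (\<Sum>f\<in>J. emeasure M (E f))"
    using sum_emeasure[of E J M] EM finJ by (metis image_subsetI)
  also have "\<dots> = of_nat (card J) * emeasure M (E (\<lambda>_. 0))"
    by (subst same) simp
  finally have "measure M cube = real (card J) * measure M (E (\<lambda>_. 0))"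
    by (simp add: measure_def enn2real_mult)
  moreover have "measure M cube \<noteq> 0"
    using emeasure_cube_pos emeasure_cube_finite by (simp add: measure_def enn2real_eq_0_iff)
  moreover have "card J = CARD('a) ^ card I" using fin by (simp add: J_def card_PiE)
  moreover have "measure P {x. \<forall>i\<in>I. l i x = 0} = measure M (E (\<lambda>_. 0)) / measure M cube"
  proof -
    have "{x. \<forall>i\<in>I. l i x = 0} = (\<Inter>i\<in>I. l i -` {0} \<inter> space M)" by auto
    moreover have "(\<Inter>i\<in>I. l i -` {0} \<inter> space M) \<in> sets M" 
      using fin measurable_sets[OF meas] sets.top[of M]
      by (cases "I = {}") (auto intro!: sets.finite_INT)
    ultimately have "{x. \<forall>i\<in>I. l i x = 0} \<in> sets M" by simp
    thus ?thesis unfolding P_def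
      by (subst measure_uniform_measure[OF emeasure_cube_pos emeasure_cube_finite])
         (auto simp: E_def Int_commute)
  qed
  ultimately show ?thesis by (simp add: field_simps)
qed

text \<open>
  The countably many lattice translates of the cube cover the space.
\<close>

lemma AE_of_cube:
  assumes per: "\<And>x c. c \<in> lattice \<Longrightarrow> R (\<lambda>k. c k + x k) \<Longrightarrow> R x"
    and AE: "AE x in P. R x"
  shows "AE x in M. R x"
proof -
  have "AE x in M. x \<in> cube \<longrightarrow> R x"
    using AE unfolding P_def
    by (subst (asm) AE_uniform_measure[OF emeasure_cube_pos])
       (use emeasure_cube_finite in \<open>auto simp: less_top\<close>)
  hence "AE x in distr M M (\<lambda>x k. c k + x k). x \<in> cube \<longrightarrow> R x" for c
    unfolding distr_M_translate .
  hence *: "AE x in M. (\<lambda>k. c k + x k) \<in> cube \<longrightarrow> R (\<lambda>k. c k + x k)" for c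
    by (rule AE_distrD[OF measurable_M_translate, where P = "\<lambda>x. x \<in> cube \<longrightarrow> R x"])
  have "countable lattice"
  proof -
    have "lattice = PiE UNIV (\<lambda>_. fls_polys)" by (auto simp: lattice_def PiE_iff)
    thus ?thesis using countable_PiE[of UNIV "\<lambda>_::'k. fls_polys :: 'a fls set"] countable_fls_polys by auto
  qed
  with * have "AE x in M. \<forall>c\<in>lattice. (\<lambda>k. c k + x k) \<in> cube \<longrightarrow> R (\<lambda>k. c k + x k)"
    by (simp add: AE_ball_countable)
  thus ?thesis
  proof eventually_elim
    case (elim x)
    define c where "c = (\<lambda>k. - poly_part (x k))"
    have "c \<in> lattice" by (auto simp: c_def lattice_def intro: fls_polys_uminus)
    moreover have "(\<lambda>k. c k + x k) \<in> cube" by (auto simp: c_def cube_def)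
    ultimately show ?case using elim per by blast
  qed
qed

end

section \<open>Linear forms on the unit cube\<close>

definition dot :: "('m \<times> 'n::finite \<Rightarrow> 'a::field fls) \<Rightarrow> 'm \<Rightarrow> 'a fls ^ 'n \<Rightarrow> 'a fls" where
  "dot x i z = (\<Sum>j\<in>UNIV. x (i, j) * z $ j)"

text \<open>
  The matrices for which, in every row \<open>i\<close>, the first \<open>K i\<close> fractional coefficients of the linear form
  \<open>z i\<close> vanish. The form may depend on the row, since the event used below for proportional denominators
  changes the form in a single row.
\<close>

definition cyl :: "('m \<Rightarrow> 'a::field fls ^ 'n::finite) \<Rightarrow> ('m \<Rightarrow> int) \<Rightarrow> ('m \<times> 'n \<Rightarrow> 'a fls) set" where
  "cyl z K = {x. \<forall>i. \<forall>n\<in>{1..K i}. dot x i (z i) $$ n = 0}"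

lemma dot_add: "dot (\<lambda>k. x k + y k) i z = dot x i z + dot y i z"
  by (simp add: dot_def distrib_right sum.distrib)

text \<open>
  Index \<open>n \<ge> 1\<close> belongs to the \<open>n\<close>-th negative power of the indeterminate, so the condition says that
  \<open>t\<close> lies at distance less than \<open>CARD('a) powi (- k)\<close> from a polynomial.
\<close>

lemma coeffs_vanish_iff:
  fixes t :: "'a::field fls"
  shows "(\<forall>n\<in>{1..k}. t $$ n = 0) \<longleftrightarrow> (\<exists>p\<in>fls_polys. t - p \<in> fls_ball k)"
proof
  assume "\<forall>n\<in>{1..k}. t $$ n = 0"
  hence "t - poly_part t \<in> fls_ball k" by (auto simp: fls_ball_def poly_part_nth)
  thus "\<exists>p\<in>fls_polys. t - p \<in> fls_ball k" using poly_part_in_polys by blast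
qed (auto simp: fls_ball_def fls_polys_iff)

text \<open>
  The first \<open>k\<close>, respectively \<open>k'\<close>, fractional coefficients of two linear forms can be prescribed
  simultaneously. By \<open>prob_kernel\<close> this yields independence.
\<close>

definition jointly_onto :: "'a::field fls ^ 'n::finite \<Rightarrow> 'a fls ^ 'n \<Rightarrow> int \<Rightarrow> int \<Rightarrow> bool" where
  "jointly_onto q q' k k' \<longleftrightarrow> (\<forall>y y'. \<exists>x :: 'n \<Rightarrow> 'a fls.
     (\<forall>n\<in>{1..k}. (\<Sum>j\<in>UNIV. x j * q $ j) $$ n = y $$ n) \<and>
     (\<forall>n\<in>{1..k'}. (\<Sum>j\<in>UNIV. x j * q' $ j) $$ n = y' $$ n))"

lemma linear_form_onto:
  fixes w :: "'a::field fls ^ 'n::finite"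
  assumes "w \<noteq> 0"
  shows "\<exists>x :: 'n \<Rightarrow> 'a fls. (\<Sum>j\<in>UNIV. x j * w $ j) = y"
proof -
  obtain j0 where "w $ j0 \<noteq> 0" using assms by (auto simp: vec_eq_iff)
  hence "(\<Sum>j\<in>UNIV. (if j = j0 then y / w $ j0 else 0) * w $ j) = y"
    by (simp add: if_distrib[of "\<lambda>c. c * _"] cong: if_cong)
  thus ?thesis by (intro exI[of _ "\<lambda>j. if j = j0 then y / w $ j0 else 0"])
qed

text \<open>
  Cramer's rule for a nonvanishing minor solves both equations exactly.
\<close>

lemma jointly_onto_independent:
  fixes q q' :: "'a::field fls ^ 'n::finite"
  assumes "q $ i * q' $ j \<noteq> q $ j * q' $ i"
  shows "jointly_onto q q' k k'"
  unfolding jointly_onto_def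
proof (intro allI)
  fix y y' :: "'a fls"
  define \<Delta> where "\<Delta> = q $ i * q' $ j - q $ j * q' $ i"
  have \<Delta>: "\<Delta> \<noteq> 0" and ij: "i \<noteq> j" using assms by (auto simp: \<Delta>_def)
  define x where "x l = (if l = i then (y * q' $ j - y' * q $ j) / \<Delta>
     else if l = j then (y' * q $ i - y * q' $ i) / \<Delta> else 0)" for l
  have sum: "(\<Sum>l\<in>UNIV. x l * z $ l) = x i * z $ i + x j * z $ j" for z :: "'a fls ^ 'n"
  proof -
    have "(\<Sum>l\<in>UNIV. x l * z $ l) = (\<Sum>l\<in>{i, j}. x l * z $ l)"
      by (rule sum.mono_neutral_right) (auto simp: x_def)
    thus ?thesis using ij by simp
  qed
  have xi: "x i = (y * q' $ j - y' * q $ j) / \<Delta>" and xj: "x j = (y' * q $ i - y * q' $ i) / \<Delta>"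
    using ij by (simp_all add: x_def)
  have "x i * z + x j * z' = ((y * q' $ j - y' * q $ j) * z + (y' * q $ i - y * q' $ i) * z') / \<Delta>" for z z'
    by (simp add: xi xj add_divide_distrib)
  moreover have "(y * q' $ j - y' * q $ j) * q $ i + (y' * q $ i - y * q' $ i) * q $ j = y * \<Delta>"
    "(y * q' $ j - y' * q $ j) * q' $ i + (y' * q $ i - y * q' $ i) * q' $ j = y' * \<Delta>"
    by (simp_all add: \<Delta>_def algebra_simps)
  ultimately have "(\<Sum>l\<in>UNIV. x l * q $ l) = y" "(\<Sum>l\<in>UNIV. x l * q' $ l) = y'"
    using \<Delta> unfolding sum by simp_all
  thus "\<exists>x. (\<forall>n\<in>{1..k}. (\<Sum>j\<in>UNIV. x j * q $ j) $$ n = y $$ n) \<and>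
     (\<forall>n\<in>{1..k'}. (\<Sum>j\<in>UNIV. x j * q' $ j) $$ n = y' $$ n)" by metis
qed

text \<open>
  Solving \<open>v x\<^sub>0 = y' + p'\<close> exactly leaves an error in the equation for \<open>u\<close> that is divided by \<open>v\<close>. The
  Bezout identity provides polynomials \<open>p\<close>, \<open>p'\<close> that remove the polynomial part of that error, and then
  division by \<open>v\<close> makes it small enough, because \<open>k\<close> does not exceed the degree of \<open>v\<close>.
\<close>

lemma jointly_onto_proportional:
  fixes q q' w :: "'a::field fls ^ 'n::finite"
  assumes uv: "u \<in> fls_polys" "v \<in> fls_polys" "\<alpha> \<in> fls_polys" "\<beta> \<in> fls_polys"
    and "v \<noteq> 0" and bez: "\<alpha> * u + \<beta> * v = 1"
    and q: "\<And>j. q $ j = u * w $ j" "\<And>j. q' $ j = v * w $ j" and "w \<noteq> 0"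
    and k: "k \<le> - fls_subdegree v"
  shows "jointly_onto q q' k k'"
  unfolding jointly_onto_def
proof (intro allI)
  fix y y' :: "'a fls"
  define g where "g = u * y' - v * y"
  define p0 where "p0 = poly_part g"
  define x0 where "x0 = (y' - \<alpha> * p0) / v"
  have p0: "p0 \<in> fls_polys" by (simp add: p0_def)
  obtain x :: "'n \<Rightarrow> 'a fls" where x: "(\<Sum>j\<in>UNIV. x j * w $ j) = x0"
    using linear_form_onto[OF \<open>w \<noteq> 0\<close>] by blast
  have "(\<Sum>j\<in>UNIV. x j * q $ j) = u * x0"
    unfolding x[symmetric] by (simp add: q sum_distrib_left mult_ac)
  moreover have "(\<Sum>j\<in>UNIV. x j * q' $ j) = v * x0"
    unfolding x[symmetric] by (simp add: q sum_distrib_left mult_ac)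
  moreover have "\<forall>n\<in>{1..k'}. (v * x0) $$ n = y' $$ n"
  proof -
    have "v * x0 = y' - \<alpha> * p0" using \<open>v \<noteq> 0\<close> by (simp add: x0_def)
    moreover have "\<alpha> * p0 \<in> fls_polys" using uv p0 by (simp add: fls_polys_mult)
    ultimately show ?thesis by (simp add: fls_polys_iff)
  qed
  moreover have "\<forall>n\<in>{1..k}. (u * x0) $$ n = y $$ n"
  proof -
    have "v * (u * x0 - y - \<beta> * p0) = u * (v * x0) - v * y - \<beta> * v * p0" by (simp add: algebra_simps)
    also have "v * x0 = y' - \<alpha> * p0" using \<open>v \<noteq> 0\<close> by (simp add: x0_def)
    also have "u * (y' - \<alpha> * p0) - v * y - \<beta> * v * p0 = g - (\<alpha> * u + \<beta> * v) * p0"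
      by (simp add: g_def algebra_simps)
    also have "\<dots> = g - p0" by (simp add: bez)
    finally have "v * (u * x0 - y - \<beta> * p0) \<in> fls_ball 0" by (simp add: p0_def)
    hence "u * x0 - y - \<beta> * p0 \<in> fls_ball (- fls_subdegree v)"
      using fls_ball_mult_cancel[OF \<open>v \<noteq> 0\<close>] by fastforce
    hence "u * x0 - y - \<beta> * p0 \<in> fls_ball k" using k by (rule fls_ball_mono[rotated])
    moreover have "\<beta> * p0 \<in> fls_polys" using uv p0 by (simp add: fls_polys_mult)
    ultimately have "\<forall>n\<in>{1..k}. (u * x0 - y) $$ n = 0" unfolding coeffs_vanish_iff by blast
    thus ?thesis by simp
  qed
  ultimately show "\<exists>x. (\<forall>n\<in>{1..k}. (\<Sum>j\<in>UNIV. x j * q $ j) $$ n = y $$ n) \<and>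
     (\<forall>n\<in>{1..k'}. (\<Sum>j\<in>UNIV. x j * q' $ j) $$ n = y' $$ n)" by metis
qed

text \<open>
  The complementary regime. If \<open>p\<close> and \<open>p'\<close> are the polynomials near \<open>u t\<close> and \<open>v t\<close>, then \<open>u p' - v p\<close>
  is a polynomial of absolute value less than 1, so it is zero. By coprimality \<open>p\<close> and \<open>p'\<close> are the multiples
  by \<open>u\<close> and \<open>v\<close> of one polynomial \<open>r\<close>, and dividing by \<open>v\<close> shows how close \<open>t\<close> is to \<open>r\<close>.
\<close>

lemma common_approximation:
  fixes t :: "'a::field fls"
  assumes uv: "u \<in> fls_polys" "v \<in> fls_polys" "\<alpha> \<in> fls_polys" "\<beta> \<in> fls_polys"
    and "u \<noteq> 0" "v \<noteq> 0" and bez: "\<alpha> * u + \<beta> * v = 1"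
    and deg: "fls_subdegree v \<le> fls_subdegree u" and k: "- fls_subdegree v \<le> k" "k \<le> k'"
    and ut: "\<forall>n\<in>{1..k}. (u * t) $$ n = 0" and vt: "\<forall>n\<in>{1..k'}. (v * t) $$ n = 0"
  shows "\<forall>n\<in>{1..k' - fls_subdegree v}. t $$ n = 0"
proof -
  obtain p where p: "p \<in> fls_polys" "u * t - p \<in> fls_ball k"
    using ut unfolding coeffs_vanish_iff by blast
  obtain p' where p': "p' \<in> fls_polys" "v * t - p' \<in> fls_ball k'"
    using vt unfolding coeffs_vanish_iff by blast
  have "v * (u * t - p) \<in> fls_ball 0"
    using fls_ball_mono[OF _ p(2), of "0 - fls_subdegree v"] k fls_ball_mult_cancel[OF \<open>v \<noteq> 0\<close>] by simp
  moreover have "u * (v * t - p') \<in> fls_ball 0"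
    using fls_ball_mono[OF _ p'(2), of "0 - fls_subdegree u"] k deg fls_ball_mult_cancel[OF \<open>u \<noteq> 0\<close>]
    by simp
  ultimately have "v * (u * t - p) - u * (v * t - p') \<in> fls_ball 0" by (rule fls_ball_diff)
  moreover have "v * (u * t - p) - u * (v * t - p') = u * p' - v * p" by (simp add: algebra_simps)
  ultimately have "u * p' - v * p = 0"
    using uv p p' by (intro fls_polys_ball_0) (auto intro: fls_polys_diff fls_polys_mult)
  hence vp: "v * p = u * p'" by simp
  define r where "r = \<alpha> * p + \<beta> * p'"
  have "v * r = \<alpha> * (v * p) + \<beta> * v * p'" by (simp add: r_def algebra_simps)
  also have "\<dots> = (\<alpha> * u + \<beta> * v) * p'" unfolding vp by (simp add: algebra_simps)
  finally have "v * r = p'" by (simp add: bez)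
  hence "v * (t - r) \<in> fls_ball k'" using p' by (simp add: right_diff_distrib)
  hence "t - r \<in> fls_ball (k' - fls_subdegree v)" by (simp add: fls_ball_mult_cancel \<open>v \<noteq> 0\<close>)
  moreover have "r \<in> fls_polys" using uv p p' by (auto simp: r_def intro: fls_polys_add fls_polys_mult)
  ultimately show ?thesis unfolding coeffs_vanish_iff by blast
qed

definition series :: "(int \<Rightarrow> 'a::zero) \<Rightarrow> 'a fls" where
  "series g = fps_to_fls (Abs_fps (\<lambda>n. g (int n)))"

lemma series_nth: "n \<ge> 0 \<Longrightarrow> series g $$ n = g n"
  by (simp add: series_def)

locale haar_matrices = haar lam index
  for lam :: "'a::{field,finite} fls measure" and index :: "('m::finite \<times> 'n::finite) itself"
begin

lemma measurable_dot_nth: "(\<lambda>x. dot x i z $$ n) \<in> M \<rightarrow>\<^sub>M count_space UNIV"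
proof -
  have coord: "(\<lambda>x. x k) \<in> M \<rightarrow>\<^sub>M borel" for k :: "'m \<times> 'n"
    unfolding M_def measurable_cong_sets[OF refl sets_lam[symmetric]]
    by (rule measurable_component_singleton) simp
  have "(\<lambda>x. (x (i, j) * z $ j) $$ n) \<in> M \<rightarrow>\<^sub>M count_space UNIV" for j
    using measurable_compose[OF coord measurable_coeff_mult] by simp
  hence "(\<lambda>x. \<Sum>j\<in>UNIV. (x (i, j) * z $ j) $$ n) \<in> M \<rightarrow>\<^sub>M count_space UNIV"
    by (rule measurable_sum_finite_type)
  thus ?thesis by (simp add: dot_def fls_nth_sum)
qed

lemma sets_cyl [measurable]: "cyl z K \<in> sets M"
proof -
  have "{x. dot x i (z i) $$ n = 0} \<in> sets M" for i n
    using measurable_sets[OF measurable_dot_nth, of "{0}" i "z i" n] by (simp add: vimage_def)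
  hence "{x \<in> space M. \<forall>i\<in>UNIV. \<forall>n\<in>{1..K i}. dot x i (z i) $$ n = 0} \<in> sets M"
    by (intro sets.sets_Collect_finite_All) auto
  thus ?thesis by (simp add: cyl_def)
qed

lemma dot_lattice: "c \<in> lattice \<Longrightarrow> z \<in> poly_vecs \<Longrightarrow> dot c i z \<in> fls_polys"
  by (auto simp: dot_def lattice_def intro!: fls_polys_sum fls_polys_mult)

lemma prob_system:
  fixes I :: "(('a fls ^ 'n) \<times> 'm \<times> int) set"
  assumes "finite I" "\<And>z i n. (z, i, n) \<in> I \<Longrightarrow> z \<in> poly_vecs \<and> n \<ge> 1"
    and surj: "\<And>f. \<exists>x. \<forall>(z, i, n)\<in>I. dot x i z $$ n = f (z, i, n)"
  shows "measure P {x. \<forall>(z, i, n)\<in>I. dot x i z $$ n = 0} = 1 / real CARD('a) ^ card I"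
proof -
  have "measure P {x. \<forall>t\<in>I. (\<lambda>(z, i, n) x. dot x i z $$ n) t x = 0} = 1 / real CARD('a) ^ card I"
  proof (rule prob_kernel)
    fix t :: "('a fls ^ 'n) \<times> 'm \<times> int" and c :: "'m \<times> 'n \<Rightarrow> 'a fls"
    assume t: "t \<in> I" "c \<in> lattice"
    obtain z i n where t': "t = (z, i, n)" by (cases t)
    have "dot c i z \<in> fls_polys" "n \<ge> 1" using t assms(2)[of z i n] by (auto simp: t' dot_lattice)
    thus "(\<lambda>(z, i, n) x. dot x i z $$ n) t c = 0" by (simp add: t' fls_polys_iff)
  next
    fix f :: "('a fls ^ 'n) \<times> 'm \<times> int \<Rightarrow> 'a"
    obtain x where "\<forall>(z, i, n)\<in>I. dot x i z $$ n = f (z, i, n)" using surj by blast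
    thus "\<exists>x. \<forall>t\<in>I. (\<lambda>(z, i, n) x. dot x i z $$ n) t x = f t" by (intro exI[of _ x]) auto
  qed (use assms measurable_dot_nth in \<open>auto simp: dot_add\<close>)
  moreover have "{x. \<forall>t\<in>I. (\<lambda>(z, i, n) x. dot x i z $$ n) t x = 0}
      = {x. \<forall>(z, i, n)\<in>I. dot x i z $$ n = 0}" by auto
  ultimately show ?thesis by simp
qed

text \<open>
  The index set of the scalar conditions defining \<open>cyl z K\<close>. Recording the form itself in the index lets
  the conditions of two different forms be united without a tag.
\<close>

definition conds :: "('m \<Rightarrow> 'a fls ^ 'n) \<Rightarrow> ('m \<Rightarrow> int) \<Rightarrow> (('a fls ^ 'n) \<times> 'm \<times> int) set" where
  "conds z K = (\<lambda>(i, n). (z i, i, n)) ` (SIGMA i:UNIV. {1..K i})"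

lemma finite_conds: "finite (conds z K)"
  by (auto simp: conds_def)

lemma card_conds: "card (conds z K) = (\<Sum>i\<in>UNIV. nat (K i))"
proof -
  have "card (conds z K) = card (SIGMA i:(UNIV::'m set). {1..K i})"
    unfolding conds_def by (intro card_image) (auto simp: inj_on_def)
  thus ?thesis by (simp add: card_SigmaI)
qed

lemma cyl_conds: "cyl z K = {x. \<forall>(z, i, n)\<in>conds z K. dot x i z $$ n = 0}"
  by (auto simp: cyl_def conds_def)

lemma prob_cyl:
  assumes "\<And>i. z i \<in> poly_vecs" "\<And>i. z i \<noteq> 0"
  shows "measure P (cyl z K) = 1 / real CARD('a) ^ (\<Sum>i\<in>UNIV. nat (K i))"
  unfolding cyl_conds card_conds[symmetric, of K z]
proof (rule prob_system)
  fix f :: "('a fls ^ 'n) \<times> 'm \<times> int \<Rightarrow> 'a"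
  have "\<exists>x :: 'n \<Rightarrow> 'a fls. (\<Sum>j\<in>UNIV. x j * z i $ j) = series (\<lambda>n. f (z i, i, n))" for i
    using linear_form_onto assms by blast
  then obtain x :: "'m \<Rightarrow> 'n \<Rightarrow> 'a fls"
    where x: "(\<Sum>j\<in>UNIV. x i j * z i $ j) = series (\<lambda>n. f (z i, i, n))" for i by metis
  have "dot (\<lambda>(i, j). x i j) i (z i) $$ n = f (z i, i, n)" if "n \<ge> 1" for i n
    using that by (simp add: dot_def x series_nth)
  thus "\<exists>x. \<forall>(z, i, n)\<in>conds z K. dot x i z $$ n = f (z, i, n)"
    by (intro exI[of _ "\<lambda>(i, j). x i j"]) (auto simp: conds_def)
qed (use assms finite_conds in \<open>auto simp: conds_def\<close>)

lemma prob_cyl_pair: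
  assumes q: "q \<in> poly_vecs" "q' \<in> poly_vecs" "q \<noteq> q'"
    and onto: "\<And>i. jointly_onto q q' (K i) (K' i)"
  shows "measure P (cyl (\<lambda>_. q) K \<inter> cyl (\<lambda>_. q') K')
    = 1 / real CARD('a) ^ (\<Sum>i\<in>UNIV. nat (K i)) * (1 / real CARD('a) ^ (\<Sum>i\<in>UNIV. nat (K' i)))"
proof -
  let ?I = "conds (\<lambda>_. q) K \<union> conds (\<lambda>_. q') K'"
  have "card ?I = card (conds (\<lambda>_. q) K) + card (conds (\<lambda>_. q') K')"
    using q by (intro card_Un_disjoint finite_conds) (auto simp: conds_def)
  moreover have "cyl (\<lambda>_. q) K \<inter> cyl (\<lambda>_. q') K' = {x. \<forall>(z, i, n)\<in>?I. dot x i z $$ n = 0}"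
    unfolding cyl_conds by blast
  moreover have "measure P {x. \<forall>(z, i, n)\<in>?I. dot x i z $$ n = 0} = 1 / real CARD('a) ^ card ?I"
  proof (rule prob_system)
    fix f :: "('a fls ^ 'n) \<times> 'm \<times> int \<Rightarrow> 'a"
    have "\<forall>i. \<exists>x :: 'n \<Rightarrow> 'a fls.
       (\<forall>n\<in>{1..K i}. (\<Sum>j\<in>UNIV. x j * q $ j) $$ n = series (\<lambda>n. f (q, i, n)) $$ n) \<and>
       (\<forall>n\<in>{1..K' i}. (\<Sum>j\<in>UNIV. x j * q' $ j) $$ n = series (\<lambda>n. f (q', i, n)) $$ n)"
      using onto unfolding jointly_onto_def by blast
    from choice[OF this] obtain x :: "'m \<Rightarrow> 'n \<Rightarrow> 'a fls" where x: "\<And>i.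
       (\<forall>n\<in>{1..K i}. (\<Sum>j\<in>UNIV. x i j * q $ j) $$ n = series (\<lambda>n. f (q, i, n)) $$ n) \<and>
       (\<forall>n\<in>{1..K' i}. (\<Sum>j\<in>UNIV. x i j * q' $ j) $$ n = series (\<lambda>n. f (q', i, n)) $$ n)"
      by blast
    thus "\<exists>x. \<forall>(z, i, n)\<in>?I. dot x i z $$ n = f (z, i, n)"
      by (intro exI[of _ "\<lambda>(i, j). x i j"]) (auto simp: conds_def dot_def series_nth)
  qed (use q finite_conds in \<open>auto simp: conds_def\<close>)
  ultimately show ?thesis by (simp add: card_conds power_add)
qed

end

section \<open>Sizes of denominators and counting\<close>

lemma Max_range_less_iff:
  "Max (range (f :: 'i::finite \<Rightarrow> real)) < t \<longleftrightarrow> (\<forall>i. f i < t)"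
  "Max (range f) \<le> t \<longleftrightarrow> (\<forall>i. f i \<le> t)"
  by (subst Max_less_iff Max_le_iff; auto)+

lemma card_field_gt_1: "real CARD('a::{field,finite}) > 1"
proof -
  have "card {0, 1 :: 'a} \<le> CARD('a)" by (intro card_mono) auto
  thus ?thesis by simp
qed

lemma fls_abs_powr:
  fixes x :: "'a::{field,finite} fls"
  shows "fls_abs x powr c = (if x = 0 then 0 else real CARD('a) powr (- real_of_int (fls_subdegree x) * c))"
  using card_field_gt_1[where 'a='a]
  by (simp add: fls_abs_def powr_powr powr_real_of_int'[symmetric])

lemma fls_abs_powr_less_iff:
  fixes x :: "'a::{field,finite} fls"
  assumes "0 < w"
  shows "fls_abs x powr (1 / real w) < real CARD('a) powr t \<longleftrightarrow>
    x = 0 \<or> - real_of_int (fls_subdegree x) < real w * t"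
    and "fls_abs x powr (1 / real w) \<le> real CARD('a) powr t \<longleftrightarrow>
    x = 0 \<or> - real_of_int (fls_subdegree x) \<le> real w * t"
  using card_field_gt_1[where 'a='a] assms
  by (auto simp: fls_abs_powr field_simps)

text \<open>
  Division is componentwise in the field; the quotient is a polynomial vector exactly when \<open>v\<close> divides
  every entry.
\<close>

definition vdiv :: "'a::field fls ^ 'n \<Rightarrow> 'a fls \<Rightarrow> 'a fls ^ 'n" where
  "vdiv q v = (\<chi> j. q $ j / v)"

definition divisors :: "'a::field fls ^ 'n \<Rightarrow> 'a fls set" where
  "divisors q = {v \<in> fls_polys. v \<noteq> 0 \<and> vdiv q v \<in> poly_vecs}"

definition deg :: "'a::zero fls \<Rightarrow> nat" where
  "deg v = nat (- fls_subdegree v)"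

lemma int_deg: "(v :: 'a::field fls) \<in> fls_polys \<Longrightarrow> int (deg v) = - fls_subdegree v"
  using fls_subdegree_poly_nonpos[of v] by (simp add: deg_def)

lemma in_polys_below_iff: "(v :: 'a::field fls) \<in> polys_below N \<longleftrightarrow> v \<in> fls_polys \<and> (v = 0 \<or> deg v < N)"
  using fls_subdegree_poly_nonpos[of v] by (auto simp: polys_below_def fls_ball_iff deg_def)

text \<open>
  The order \<open>Q\<close> of the field is a parameter fixed by an equation, so that the definitions below depend on
  no type beyond those of their arguments.
\<close>

locale weighted_approximation = haar_matrices lam index
  for lam :: "'a::{field,finite} fls measure" and index :: "('m::finite \<times> 'n::finite) itself" +
  fixes a :: "'m + 'n \<Rightarrow> nat" and R Q :: real
  assumes a: "a \<in> weights" and R: "R > 0" and Q_def: "Q = real CARD('a)"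
begin

definition D :: nat where "D = (\<Sum>i\<in>UNIV. a (Inl i))"

lemma Q_gt_1: "Q > 1" unfolding Q_def by (rule card_field_gt_1)

lemma Q_ge_2: "Q \<ge> 2" using Q_gt_1 by (simp add: Q_def)

lemma a_pos: "0 < a k" using a by (simp add: weights_def)

lemma D_eq: "D = (\<Sum>j\<in>UNIV. a (Inr j))" using a by (simp add: weights_def D_def)

definition size :: "'a fls ^ 'n \<Rightarrow> real" where "size q = log Q (norm_beta a q)"

definition K :: "'a fls ^ 'n \<Rightarrow> 'm \<Rightarrow> int" where "K q i = \<lfloor>real (a (Inl i)) * (size q - R)\<rfloor>"

definition hits :: "'a fls ^ 'n \<Rightarrow> ('m \<times> 'n \<Rightarrow> 'a fls) set" where "hits q = cyl (\<lambda>_. q) (K q)"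

definition density :: "'a fls ^ 'n \<Rightarrow> real" where "density q = 1 / Q ^ (\<Sum>i\<in>UNIV. nat (K q i))"

definition denoms :: "nat \<Rightarrow> ('a fls ^ 'n) set" where
  "denoms T = {q \<in> poly_vecs. q \<noteq> 0 \<and> R < size q \<and> size q \<le> real T}"

lemma norm_alpha_less_iff:
  fixes y :: "'a fls ^ 'm"
  shows
  "norm_alpha a y < Q powr t \<longleftrightarrow> (\<forall>i. y $ i \<in> fls_ball \<lfloor>- (real (a (Inl i)) * t)\<rfloor>)"
  by (auto simp: Q_def norm_alpha_def Max_range_less_iff fls_abs_powr_less_iff[OF a_pos] fls_ball_iff floor_less_iff)

lemma norm_beta_less_iff:
  fixes q :: "'a fls ^ 'n"
  shows
  "norm_beta a q < Q powr t \<longleftrightarrow> (\<forall>j. q $ j = 0 \<or> - real_of_int (fls_subdegree (q $ j)) < real (a (Inr j)) * t)"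
    and "norm_beta a q \<le> Q powr t \<longleftrightarrow> (\<forall>j. q $ j = 0 \<or> - real_of_int (fls_subdegree (q $ j)) \<le> real (a (Inr j)) * t)"
  by (auto simp: Q_def norm_beta_def Max_range_less_iff fls_abs_powr_less_iff[OF a_pos])

lemma norm_beta_pos: "q \<noteq> 0 \<Longrightarrow> norm_beta a (q :: 'a fls ^ 'n) > 0"
proof -
  assume "q \<noteq> 0"
  then obtain j where j: "q $ j \<noteq> 0" by (auto simp: vec_eq_iff)
  have "0 < fls_abs (q $ j) powr (1 / real (a (Inr j)))"
    using j Q_gt_1 by (simp add: Q_def fls_abs_powr)
  also have "\<dots> \<le> norm_beta a q" unfolding norm_beta_def by (intro Max_ge) auto
  finally show ?thesis .
qed

lemma norm_beta_0: "norm_beta a (0 :: 'a fls ^ 'n) = 0"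
  by (simp add: norm_beta_def fls_abs_def)

lemma norm_beta_eq: "q \<noteq> 0 \<Longrightarrow> norm_beta a q = Q powr size q"
  using norm_beta_pos[of q] Q_gt_1 by (simp add: size_def)

lemma size_less_iff:
  assumes "q \<noteq> 0"
  shows "size q < t \<longleftrightarrow> (\<forall>j. q $ j = 0 \<or> - real_of_int (fls_subdegree (q $ j)) < real (a (Inr j)) * t)"
    and "size q \<le> t \<longleftrightarrow> (\<forall>j. q $ j = 0 \<or> - real_of_int (fls_subdegree (q $ j)) \<le> real (a (Inr j)) * t)"
  using norm_beta_less_iff[of q t] Q_gt_1 by (simp_all add: norm_beta_eq[OF assms])

lemma K_nonneg: "R < size q \<Longrightarrow> 0 \<le> K q i"
  by (simp add: K_def)

lemma density_pos: "density q > 0"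
  using Q_gt_1 by (simp add: density_def)

text \<open>
  Rounding down costs less than 1 in each of the \<open>CARD('m)\<close> rows.
\<close>

lemma density_bounds:
  assumes "R < size q"
  shows "density q \<le> Q powr (real CARD('m) - real D * (size q - R))"
    and "Q powr (- (real D * (size q - R))) \<le> density q"
proof -
  have "real (\<Sum>i\<in>UNIV. nat (K q i)) = (\<Sum>i\<in>UNIV. real_of_int (K q i))"
    using K_nonneg[OF assms] by simp
  moreover have "density q = Q powr (- real (\<Sum>i\<in>UNIV. nat (K q i)))"
    using Q_gt_1 unfolding density_def by (subst powr_minus_divide, subst powr_realpow) auto
  ultimately have d: "density q = Q powr (- (\<Sum>i\<in>UNIV. real_of_int (K q i)))" by simp
  have D: "real D * (size q - R) = (\<Sum>i\<in>UNIV. real (a (Inl i)) * (size q - R))"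
    by (simp add: D_def sum_distrib_right)
  have "(\<Sum>i\<in>UNIV. real_of_int (K q i)) \<le> real D * (size q - R)"
    unfolding D by (intro sum_mono) (simp add: K_def)
  thus "Q powr (- (real D * (size q - R))) \<le> density q" unfolding d using Q_gt_1 by simp
  have "real D * (size q - R) - real CARD('m) = (\<Sum>i\<in>(UNIV::'m set). real (a (Inl i)) * (size q - R) - 1)"
    by (simp add: D sum_subtractf)
  also have "\<dots> \<le> (\<Sum>i\<in>UNIV. real_of_int (K q i))"
  proof (rule sum_mono)
    fix i show "real (a (Inl i)) * (size q - R) - 1 \<le> real_of_int (K q i)"
      unfolding K_def by linarith
  qed
  finally show "density q \<le> Q powr (real CARD('m) - real D * (size q - R))" unfolding d using Q_gt_1 by simp
qed

definition vecs_below :: "nat \<Rightarrow> ('a fls ^ 'n) set" where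
  "vecs_below N = {q. \<forall>j. q $ j \<in> polys_below (a (Inr j) * N)}"

lemma finite_vec_set:
  assumes "\<And>j. finite (B j)" shows "finite {q :: 'b ^ 'k::finite. \<forall>j. q $ j \<in> B j}"
proof -
  have "{q :: 'b ^ 'k. \<forall>j. q $ j \<in> B j} \<subseteq> (\<lambda>f. \<chi> j. f j) ` PiE UNIV B"
  proof
    fix q :: "'b ^ 'k" assume "q \<in> {q. \<forall>j. q $ j \<in> B j}"
    thus "q \<in> (\<lambda>f. \<chi> j. f j) ` PiE UNIV B"
      by (intro image_eqI[of _ _ "\<lambda>j. q $ j"]) (auto simp: vec_eq_iff)
  qed
  thus ?thesis by (rule finite_subset) (use assms in \<open>auto intro!: finite_PiE\<close>)
qed

lemma size_less_nat_iff:
  assumes "q \<in> poly_vecs" "q \<noteq> 0"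
  shows "size q < real N \<longleftrightarrow> q \<in> vecs_below N"
proof -
  have "- real_of_int (fls_subdegree (q $ j)) < real (a (Inr j)) * real N \<longleftrightarrow> deg (q $ j) < a (Inr j) * N" for j
  proof -
    have "- real_of_int (fls_subdegree (q $ j)) = real (deg (q $ j))"
      using int_deg[of "q $ j"] assms by simp
    thus ?thesis by (metis of_nat_less_iff of_nat_mult)
  qed
  thus ?thesis
    using assms by (simp add: size_less_iff[OF assms(2)] vecs_below_def in_polys_below_iff)
qed

lemma denoms_subset: "denoms T \<subseteq> vecs_below (Suc T)"
proof
  fix q assume "q \<in> denoms T"
  thus "q \<in> vecs_below (Suc T)"
    by (subst size_less_nat_iff[symmetric]) (auto simp: denoms_def)
qed

lemma finite_denoms [simp]: "finite (denoms T)"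
proof (rule finite_subset)
  show "denoms T \<subseteq> vecs_below (Suc T)" by (rule denoms_subset)
qed (auto simp: vecs_below_def intro!: finite_vec_set)

lemma finite_divisors:
  fixes q :: "'a fls ^ 'n"
  assumes "q \<in> poly_vecs" "q \<noteq> 0" shows "finite (divisors q)"
proof -
  obtain j where j: "q $ j \<noteq> 0" using assms by (auto simp: vec_eq_iff)
  have "divisors q \<subseteq> polys_below (Suc (deg (q $ j)))"
  proof
    fix v assume v: "v \<in> divisors q"
    hence "q $ j / v \<in> fls_polys" "v \<noteq> 0" "v \<in> fls_polys" by (auto simp: divisors_def vdiv_def)
    moreover have "fls_subdegree (q $ j) = fls_subdegree v + fls_subdegree (q $ j / v)"
      using j \<open>v \<noteq> 0\<close> by (subst fls_subdegree_mult[symmetric]) auto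
    ultimately show "v \<in> polys_below (Suc (deg (q $ j)))"
      using fls_subdegree_poly_nonpos[of "q $ j / v"] by (auto simp: in_polys_below_iff deg_def)
  qed
  thus ?thesis by (rule finite_subset) simp
qed

text \<open>
  A pair is determined by \<open>v\<close>, by \<open>q\<^sub>j / v\<close> for one \<open>j\<close> with \<open>q\<^sub>j \<noteq> 0\<close>, and by the remaining entries. The
  choice of \<open>v\<close> costs a factor \<open>Q\<^sup>V\<^sup>+\<^sup>1\<close>, and the passage from \<open>q\<^sub>j\<close> to \<open>q\<^sub>j / v\<close> gains \<open>Q\<^sup>V\<close>, so the bound does
  not depend on \<open>V\<close>.
\<close>

lemma card_divisor_pairs:
  defines "S V N \<equiv> {(q, v). q \<in> vecs_below N \<and> q \<noteq> 0 \<and> v \<in> divisors q \<and> deg v = V}"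
  shows "finite (S V N)" "real (card (S V N)) \<le> real CARD('n) * Q * Q ^ (D * N)"
proof -
  define dom :: "'n \<Rightarrow> ('a fls \<times> 'a fls \<times> ('n \<Rightarrow> 'a fls)) set"
    where "dom j0 = polys_below (Suc V) \<times> polys_below (a (Inr j0) * N - V)
     \<times> PiE (UNIV - {j0}) (\<lambda>j. polys_below (a (Inr j) * N))" for j0
  define f where "f j0 = (\<lambda>(v, w, g). ((\<chi> j. if j = j0 then v * w else g j) :: 'a fls ^ 'n, v))" for j0 :: 'n
  define J where "J = {j0 :: 'n. V < a (Inr j0) * N}"
  have sub: "S V N \<subseteq> (\<Union>j0\<in>J. f j0 ` dom j0)"
  proof (clarify)
    fix q v assume qv: "(q, v) \<in> S V N"
    hence q: "q \<in> vecs_below N" "q \<noteq> 0" and v: "v \<noteq> 0" "v \<in> fls_polys" "\<And>j. q $ j / v \<in> fls_polys" "deg v = V"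
      by (auto simp: S_def divisors_def vdiv_def)
    then obtain j0 where j0: "q $ j0 \<noteq> 0" by (auto simp: vec_eq_iff)
    define w where "w = q $ j0 / v"
    have w: "w \<noteq> 0" "w \<in> fls_polys" "v * w = q $ j0" using j0 v by (auto simp: w_def)
    have "fls_subdegree (q $ j0) = fls_subdegree v + fls_subdegree w" using w v by (metis fls_subdegree_mult)
    hence "deg (q $ j0) = V + deg w" using w v fls_subdegree_poly_nonpos[of v] fls_subdegree_poly_nonpos[of w]
      by (auto simp: deg_def)
    moreover have "deg (q $ j0) < a (Inr j0) * N" using q j0 by (auto simp: vecs_below_def in_polys_below_iff)
    ultimately have "j0 \<in> J" "deg w < a (Inr j0) * N - V" by (auto simp: J_def)
    moreover have "(q, v) \<in> f j0 ` dom j0"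
    proof (rule image_eqI)
      show "(q, v) = f j0 (v, w, restrict (\<lambda>j. q $ j) (UNIV - {j0}))"
        using w by (auto simp: f_def vec_eq_iff)
      show "(v, w, restrict (\<lambda>j. q $ j) (UNIV - {j0})) \<in> dom j0"
        using v w q calculation by (auto simp: dom_def in_polys_below_iff vecs_below_def)
    qed
    ultimately show "(q, v) \<in> (\<Union>j0\<in>J. f j0 ` dom j0)" by blast
  qed
  have fin: "finite (dom j0)" for j0
    unfolding dom_def by (intro finite_cartesian_product finite_PiE finite_polys_below) auto
  show "finite (S V N)" by (rule finite_subset[OF sub]) (auto simp: fin)
  have card_dom: "card (dom j0) = CARD('a) * CARD('a) ^ (D * N)" if "j0 \<in> J" for j0
  proof -
    have "card (dom j0) = CARD('a) ^ Suc V * (CARD('a) ^ (a (Inr j0) * N - V) *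
        (\<Prod>j\<in>UNIV - {j0}. CARD('a) ^ (a (Inr j) * N)))"
      unfolding dom_def by (simp only: card_cartesian_product card_PiE finite card_polys_below)
    also have "(\<Prod>j\<in>UNIV - {j0}. CARD('a) ^ (a (Inr j) * N)) = CARD('a) ^ (\<Sum>j\<in>UNIV - {j0}. a (Inr j) * N)"
      by (simp add: power_sum)
    also have "CARD('a) ^ Suc V * (CARD('a) ^ (a (Inr j0) * N - V) * CARD('a) ^ (\<Sum>j\<in>UNIV - {j0}. a (Inr j) * N))
      = CARD('a) ^ (Suc V + (a (Inr j0) * N - V) + (\<Sum>j\<in>UNIV - {j0}. a (Inr j) * N))"
      by (simp only: power_add mult.assoc)
    also have "Suc V + (a (Inr j0) * N - V) + (\<Sum>j\<in>UNIV - {j0}. a (Inr j) * N)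
      = Suc (\<Sum>j\<in>UNIV. a (Inr j) * N)"
      using that by (subst sum.remove[of _ j0]) (auto simp: J_def)
    also have "(\<Sum>j\<in>UNIV. a (Inr j) * N) = D * N" by (simp add: D_eq sum_distrib_right)
    finally show ?thesis by simp
  qed
  have "card (S V N) \<le> card (\<Union>j0\<in>J. f j0 ` dom j0)" by (rule card_mono[OF _ sub]) (auto simp: fin)
  also have "\<dots> \<le> (\<Sum>j0\<in>J. card (f j0 ` dom j0))" by (rule card_UN_le) simp
  also have "\<dots> \<le> (\<Sum>j0\<in>J. CARD('a) * CARD('a) ^ (D * N))"
    by (intro sum_mono) (metis card_dom card_image_le fin)
  also have "\<dots> \<le> CARD('n) * (CARD('a) * CARD('a) ^ (D * N))"
    by (simp add: card_mono)
  finally have "real (card (S V N)) \<le> real (CARD('n) * (CARD('a) * CARD('a) ^ (D * N)))"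
    by (rule of_nat_mono)
  thus "real (card (S V N)) \<le> real CARD('n) * Q * Q ^ (D * N)" by (simp add: Q_def mult.assoc)
qed

definition C0 :: real where
  "C0 = real CARD('n) * Q * Q ^ D * Q powr (real CARD('m) + real D * R)"

lemma C0_pos: "C0 > 0" using Q_gt_1 by (simp add: C0_def)

text \<open>
  In the range \<open>\<sigma> \<le> size q < \<sigma> + 1\<close> the number of pairs is \<open>O(Q\<^sup>D\<^sup>\<sigma>)\<close> and the density is \<open>O(Q\<^sup>-\<^sup>D\<^sup>\<sigma>)\<close>, so each
  \<open>\<sigma>\<close> contributes a bounded amount.
\<close>

lemma sum_divisor_pairs:
  defines "S \<equiv> \<lambda>V T. {(q, v). q \<in> denoms T \<and> v \<in> divisors q \<and> deg v = V}"
  shows "finite (S V T)" "(\<Sum>(q, v)\<in>S V T. density q) \<le> C0 * (real T + 1)"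
proof -
  define B where "B N = {(q, v). q \<in> vecs_below N \<and> q \<noteq> 0 \<and> v \<in> divisors q \<and> deg v = V}" for N
  have B: "finite (B N)" "real (card (B N)) \<le> real CARD('n) * Q * Q ^ (D * N)" for N
    using card_divisor_pairs unfolding B_def by auto
  have "S V T \<subseteq> B (Suc T)"
    using denoms_subset[of T] by (auto simp: S_def B_def denoms_def)
  thus fin: "finite (S V T)" using B finite_subset by blast
  define lev where "lev = (\<lambda>(q :: 'a fls ^ 'n, v :: 'a fls). nat \<lfloor>size q\<rfloor>)"
  have "lev ` S V T \<subseteq> {..T}"
    by (auto simp: lev_def S_def denoms_def le_nat_iff floor_le_iff nat_le_iff)
  hence "(\<Sum>(q, v)\<in>S V T. density q)
      = (\<Sum>\<sigma>\<le>T. \<Sum>(q, v)\<in>{t \<in> S V T. lev t = \<sigma>}. density q)"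
    using fin by (intro sum.group[symmetric]) auto
  also have "\<dots> \<le> (\<Sum>\<sigma>\<le>T. C0)"
  proof (rule sum_mono)
    fix \<sigma> assume "\<sigma> \<in> {..T}"
    let ?L = "{t \<in> S V T. lev t = \<sigma>}"
    have L: "real \<sigma> \<le> size q" "size q < real (Suc \<sigma>)" "R < size q" "q \<in> poly_vecs" "q \<noteq> 0"
      if "(q, v) \<in> ?L" for q v
    proof -
      show Rq: "R < size q" and "q \<in> poly_vecs" "q \<noteq> 0" using that by (auto simp: S_def denoms_def)
      have "\<lfloor>size q\<rfloor> = int \<sigma>" using that Rq R by (auto simp: lev_def)
      thus "real \<sigma> \<le> size q" "size q < real (Suc \<sigma>)" by linarith+
    qed
    have "?L \<subseteq> B (Suc \<sigma>)"
      using L(2,4,5) size_less_nat_iff[of _ "Suc \<sigma>"] by (fastforce simp: S_def B_def)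
    hence card: "real (card ?L) \<le> real CARD('n) * Q * Q ^ (D * Suc \<sigma>)"
      using B(2)[of "Suc \<sigma>"] card_mono[OF B(1)] by (meson of_nat_mono order_trans)
    have "(\<Sum>(q, v)\<in>?L. density q) \<le> (\<Sum>(q, v)\<in>?L. Q powr (real CARD('m) - real D * (real \<sigma> - R)))"
    proof (intro sum_mono, clarify)
      fix q v assume "(q, v) \<in> S V T" "\<sigma> = lev (q, v)"
      hence "real \<sigma> \<le> size q" "R < size q" using L by auto
      thus "density q \<le> Q powr (real CARD('m) - real D * (real (lev (q, v)) - R))"
        using Q_gt_1 \<open>\<sigma> = _\<close> by (intro order_trans[OF density_bounds(1)]) (auto intro!: mult_left_mono)
    qed
    also have "\<dots> = real (card ?L) * Q powr (real CARD('m) - real D * (real \<sigma> - R))"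
      by (simp add: case_prod_unfold)
    also have "\<dots> \<le> real CARD('n) * Q * Q ^ (D * Suc \<sigma>) * Q powr (real CARD('m) - real D * (real \<sigma> - R))"
      by (intro mult_right_mono card) auto
    also have "Q ^ (D * Suc \<sigma>) = Q ^ D * Q powr (real D * real \<sigma>)"
      using Q_gt_1 by (simp add: power_add powr_realpow[symmetric])
    also have "real CARD('n) * Q * (Q ^ D * Q powr (real D * real \<sigma>)) * Q powr (real CARD('m) - real D * (real \<sigma> - R))
      = real CARD('n) * Q * Q ^ D * Q powr (real D * real \<sigma> + (real CARD('m) - real D * (real \<sigma> - R)))"
      by (simp only: powr_add mult.assoc)
    also have "\<dots> = C0" by (simp add: C0_def algebra_simps)
    finally show "(\<Sum>(q, v)\<in>?L. density q) \<le> C0" .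
  qed
  also have "\<dots> = C0 * (real T + 1)" by (simp add: algebra_simps)
  finally show "(\<Sum>(q, v)\<in>S V T. density q) \<le> C0 * (real T + 1)" .
qed

definition main_term :: "nat \<Rightarrow> real" where "main_term T = (\<Sum>q\<in>denoms T. density q)"

lemma main_term_upper: "main_term T \<le> C0 * (real T + 1)"
proof -
  let ?S = "{(q, v). q \<in> denoms T \<and> v \<in> divisors q \<and> deg v = 0}"
  have "main_term T = (\<Sum>(q, v)\<in>(\<lambda>q. (q, 1 :: 'a fls)) ` denoms T. density q)"
    unfolding main_term_def by (subst sum.reindex) (auto simp: inj_on_def)
  also have "\<dots> \<le> (\<Sum>(q, v)\<in>?S. density q)"
    by (intro sum_mono2 sum_divisor_pairs)
       (auto simp: divisors_def vdiv_def deg_def denoms_def intro: less_imp_le[OF density_pos])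
  also have "\<dots> \<le> C0 * (real T + 1)" by (rule sum_divisor_pairs)
  finally show ?thesis .
qed

text \<open>
  A vector of size exactly \<open>\<sigma>\<close> arises by fixing one entry to be monic of degree \<open>a\<^sub>j \<sigma>\<close> and choosing the
  others of smaller degree; this gives \<open>Q\<^sup>D\<^sup>\<sigma>\<close> vectors.
\<close>

lemma level_lower:
  assumes "R < real \<sigma>"
  shows "finite {q \<in> poly_vecs. q \<noteq> 0 \<and> size q = real \<sigma>}"
    and "1 \<le> (\<Sum>q\<in>{q \<in> poly_vecs. q \<noteq> 0 \<and> size q = real \<sigma>}. density q)"
proof -
  let ?L = "{q \<in> poly_vecs. q \<noteq> 0 \<and> size q = real \<sigma>}"
  have "?L \<subseteq> denoms \<sigma>" using assms by (auto simp: denoms_def)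
  thus fin: "finite ?L" by (rule finite_subset) simp
  obtain j0 :: 'n where True by auto
  define lead :: "'a fls" where "lead = fls_X_intpow (- int (a (Inr j0) * \<sigma>))"
  define F :: "('n \<Rightarrow> 'a fls) set" where "F = PiE UNIV (\<lambda>j. polys_below (a (Inr j) * \<sigma>))"
  define f where "f g = (\<chi> j. g j + (if j = j0 then lead else 0))" for g :: "'n \<Rightarrow> 'a fls"
  have cF: "card F = CARD('a) ^ (D * \<sigma>)"
    by (simp add: F_def card_PiE card_polys_below power_sum D_eq sum_distrib_right)
  have inj: "inj_on f F" by (auto simp: inj_on_def f_def vec_eq_iff fun_eq_iff)
  have img: "f ` F \<subseteq> ?L"
  proof (rule image_subsetI, rule CollectI, intro conjI)
    fix g assume "g \<in> F"
    hence g: "g j \<in> polys_below (a (Inr j) * \<sigma>)" for j by (auto simp: F_def)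
    have lead: "lead \<in> fls_polys" 
    proof -
      have "(fls_X_intpow (- int N) :: 'a fls) \<in> fls_polys" for N by (auto simp: fls_polys_iff)
      thus ?thesis unfolding lead_def .
    qed
    show fp: "f g \<in> poly_vecs"
      using g lead by (auto simp: f_def polys_below_def intro: fls_polys_add)
    have nth: "f g $ j0 $$ (- int (a (Inr j0) * \<sigma>)) = 1"
      using g[of j0] by (simp add: f_def lead_def polys_below_def fls_ball_def)
    hence "f g $ j0 \<noteq> 0" by auto
    thus nz: "f g \<noteq> 0" by (auto simp: vec_eq_iff)
    have "f g $ j = 0 \<or> - real_of_int (fls_subdegree (f g $ j)) \<le> real (a (Inr j)) * real \<sigma>" for j
    proof -
      have "f g $ j \<in> fls_ball (- int (a (Inr j) * \<sigma>) - 1)"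
        using g[of j] by (auto simp: f_def lead_def polys_below_def fls_ball_def)
      hence "f g $ j = 0 \<or> - fls_subdegree (f g $ j) \<le> int (a (Inr j) * \<sigma>)" by (auto simp: fls_ball_iff)
      hence "f g $ j = 0 \<or> real_of_int (- fls_subdegree (f g $ j)) \<le> real_of_int (int (a (Inr j) * \<sigma>))"
        unfolding of_int_le_iff .
      thus ?thesis by simp
    qed
    hence "size (f g) \<le> real \<sigma>" by (simp add: size_less_iff[OF nz])
    moreover have "\<not> size (f g) < real \<sigma>"
    proof
      assume "size (f g) < real \<sigma>"
      hence "f g $ j0 \<in> polys_below (a (Inr j0) * \<sigma>)"
        using size_less_nat_iff[of "f g" \<sigma>] fp nz by (auto simp: vecs_below_def)
      thus False using nth by (simp add: polys_below_def fls_ball_def)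
    qed
    ultimately show "size (f g) = real \<sigma>" by simp
  qed
  have "CARD('a) ^ (D * \<sigma>) \<le> card ?L" using card_inj_on_le[OF inj img fin] by (simp add: cF)
  hence "real (CARD('a) ^ (D * \<sigma>)) \<le> real (card ?L)" by (rule of_nat_mono)
  hence card: "Q ^ (D * \<sigma>) \<le> real (card ?L)" by (simp add: Q_def)
  have "1 = Q ^ (D * \<sigma>) * Q powr (- (real D * real \<sigma>))"
    using Q_gt_1 by (simp add: powr_realpow[symmetric] powr_add[symmetric])
  also have "\<dots> \<le> real (card ?L) * Q powr (- (real D * (real \<sigma> - R)))"
    using Q_gt_1 R by (intro mult_mono card) (auto simp: algebra_simps)
  also have "\<dots> = (\<Sum>q\<in>?L. Q powr (- (real D * (real \<sigma> - R))))" by simp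
  also have "\<dots> \<le> (\<Sum>q\<in>?L. density q)"
  proof (rule sum_mono)
    fix q assume "q \<in> ?L"
    hence "size q = real \<sigma>" by simp
    thus "Q powr (- (real D * (real \<sigma> - R))) \<le> density q"
      using density_bounds(2)[of q] assms by simp
  qed
  finally show "1 \<le> (\<Sum>q\<in>?L. density q)" .
qed

lemma main_term_lower: "real T - R - 1 \<le> main_term T"
proof -
  define I where "I = {\<sigma>. R < real \<sigma> \<and> \<sigma> \<le> T}"
  define L where "L \<sigma> = {q \<in> poly_vecs. q \<noteq> 0 \<and> size q = real \<sigma>}" for \<sigma>
  have "{Suc (nat \<lfloor>R\<rfloor>)..T} \<subseteq> I" using R by (auto simp: I_def) linarith
  moreover have finI: "finite I" unfolding I_def by (rule finite_subset[of _ "{..T}"]) auto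
  ultimately have "card {Suc (nat \<lfloor>R\<rfloor>)..T} \<le> card I" by (intro card_mono)
  hence "T - nat \<lfloor>R\<rfloor> \<le> card I" by simp
  hence "real T - R - 1 \<le> real (card I)" using R by linarith
  also have "\<dots> = (\<Sum>\<sigma>\<in>I. 1)" by simp
  also have "\<dots> \<le> (\<Sum>\<sigma>\<in>I. sum density (L \<sigma>))"
    unfolding L_def using level_lower by (intro sum_mono) (auto simp: I_def)
  also have "\<dots> = sum density (\<Union>\<sigma>\<in>I. L \<sigma>)"
    using finI level_lower by (intro sum.UNION_disjoint[symmetric]) (auto simp: I_def L_def)
  also have "\<dots> \<le> main_term T"
    unfolding main_term_def
    by (intro sum_mono2[OF finite_denoms]) (auto simp: denoms_def I_def L_def less_imp_le[OF density_pos])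
  finally show ?thesis .
qed

end

section \<open>Maximal inequality for dyadic sums\<close>

text \<open>
  The sum of the squares of all dyadic block sums of \<open>z\<close> inside \<open>{s..<s + 2 ^ k}\<close>.
\<close>

fun dyadic :: "(nat \<Rightarrow> real) \<Rightarrow> nat \<Rightarrow> nat \<Rightarrow> real" where
  "dyadic z s 0 = (z s)\<^sup>2"
| "dyadic z s (Suc k) = (\<Sum>t\<in>{s..<s + 2 ^ Suc k}. z t)\<^sup>2 + dyadic z s k + dyadic z (s + 2 ^ k) k"

lemma dyadic_nonneg: "0 \<le> dyadic z s k"
  by (induction k arbitrary: s) auto

lemma block_le_dyadic: "(\<Sum>t\<in>{s..<s + 2 ^ k}. z t)\<^sup>2 \<le> dyadic z s k"
  using dyadic_nonneg[of z] by (cases k) (auto simp: add_nonneg_nonneg)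

text \<open>
  Cauchy--Schwarz with weights 1 and \<open>c\<close>.
\<close>

lemma square_add_le:
  fixes x y c :: real
  assumes "c > 0" "y\<^sup>2 \<le> c * w"
  shows "(x + y)\<^sup>2 \<le> (c + 1) * (x\<^sup>2 + w)"
proof -
  have "(x + y)\<^sup>2 \<le> (c + 1) * (x\<^sup>2 + y\<^sup>2 / c)"
  proof -
    have "(c + 1) * (x\<^sup>2 + y\<^sup>2 / c) - (x + y)\<^sup>2 = (c * x - y)\<^sup>2 / c"
      using assms by (simp add: field_simps power2_eq_square)
    also have "\<dots> \<ge> 0" using assms by simp
    finally show ?thesis by simp
  qed
  also have "y\<^sup>2 / c \<le> w" using assms by (simp add: field_simps)
  hence "(c + 1) * (x\<^sup>2 + y\<^sup>2 / c) \<le> (c + 1) * (x\<^sup>2 + w)" using assms by (intro mult_left_mono) auto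
  finally show ?thesis .
qed

text \<open>
  An initial segment is a disjoint union of at most one dyadic block of each of the \<open>k + 1\<close> lengths;
  the induction splits off the longest one.
\<close>

lemma partial_sum_le_dyadic:
  assumes "T \<le> 2 ^ k"
  shows "(\<Sum>t\<in>{s..<s + T}. z t)\<^sup>2 \<le> (real k + 1) * dyadic z s k"
  using assms
proof (induction k arbitrary: s T)
  case 0
  hence "T = 0 \<or> T = 1" by auto
  thus ?case by auto
next
  case (Suc k)
  show ?case
  proof (cases "T \<le> 2 ^ k")
    case True
    hence "(\<Sum>t\<in>{s..<s + T}. z t)\<^sup>2 \<le> (real k + 1) * dyadic z s k" by (rule Suc.IH)
    also have "\<dots> \<le> (real (Suc k) + 1) * dyadic z s (Suc k)"
      using dyadic_nonneg[of z] by (intro mult_mono) auto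
    finally show ?thesis .
  next
    case False
    let ?T = "T - 2 ^ k"
    have T: "T = 2 ^ k + ?T" "?T \<le> 2 ^ k" using False Suc.prems by auto
    have "(\<Sum>t\<in>{s..<s + T}. z t) = (\<Sum>t\<in>{s..<s + 2 ^ k}. z t) + (\<Sum>t\<in>{s + 2 ^ k..<s + 2 ^ k + ?T}. z t)"
      using T(1) by (subst sum.atLeastLessThan_concat) auto
    also have "\<dots>\<^sup>2 \<le> (real k + 1 + 1) * ((\<Sum>t\<in>{s..<s + 2 ^ k}. z t)\<^sup>2 + dyadic z (s + 2 ^ k) k)"
      by (intro square_add_le Suc.IH T) auto
    also have "\<dots> \<le> (real k + 1 + 1) * dyadic z s (Suc k)"
      using block_le_dyadic[of z s k] by (intro mult_left_mono) (auto intro: add_increasing)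
    finally show ?thesis by (simp add: add_ac)
  qed
qed

text \<open>
  The blocks of one length are disjoint, so their covariance bounds are parts of the total, and there
  are \<open>k + 1\<close> lengths.
\<close>

lemma dyadic_expectation:
  fixes Z :: "nat \<Rightarrow> 'b \<Rightarrow> real" and N :: "'b measure"
  assumes int: "\<And>s t. integrable N (\<lambda>x. Z s x * Z t x)"
    and cov: "\<And>s t. (\<integral>x. Z s x * Z t x \<partial>N) \<le> h s t" and h: "\<And>s t. 0 \<le> h s t"
  shows "integrable N (\<lambda>x. dyadic (\<lambda>t. Z t x) r k) \<and>
    (\<integral>x. dyadic (\<lambda>t. Z t x) r k \<partial>N) \<le> (real k + 1) * (\<Sum>s\<in>{r..<r + 2 ^ k}. \<Sum>t\<in>{r..<r + 2 ^ k}. h s t)"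
proof (induction k arbitrary: r)
  case 0
  show ?case using int[of r r] cov[of r r] by (simp add: power2_eq_square)
next
  case (Suc k)
  let ?H = "\<lambda>r k. \<Sum>s\<in>{r..<r + 2 ^ k}. \<Sum>t\<in>{r..<r + 2 ^ k}. h s t"
  have sq: "(\<Sum>t\<in>I. Z t x)\<^sup>2 = (\<Sum>s\<in>I. \<Sum>t\<in>I. Z s x * Z t x)" for I x
    by (simp add: power2_eq_square sum_product)
  have isq: "integrable N (\<lambda>x. (\<Sum>t\<in>I. Z t x)\<^sup>2)" for I
    unfolding sq by (intro Bochner_Integration.integrable_sum int)
  have esq: "(\<integral>x. (\<Sum>t\<in>I. Z t x)\<^sup>2 \<partial>N) \<le> (\<Sum>s\<in>I. \<Sum>t\<in>I. h s t)" for I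
    unfolding sq by (subst Bochner_Integration.integral_sum, intro Bochner_Integration.integrable_sum int,
      subst Bochner_Integration.integral_sum, intro int, intro sum_mono cov)
  let ?A = "{r..<r + 2 ^ k}" and ?B = "{r + 2 ^ k..<r + 2 ^ k + 2 ^ k}" and ?C = "{r..<r + 2 ^ Suc k}"
  have halves: "?H r k + ?H (r + 2 ^ k) k \<le> ?H r (Suc k)"
  proof -
    have C: "?C = ?A \<union> ?B" "?A \<inter> ?B = {}" by auto
    have "?H r k \<le> (\<Sum>s\<in>?A. \<Sum>t\<in>?C. h s t)" "?H (r + 2 ^ k) k \<le> (\<Sum>s\<in>?B. \<Sum>t\<in>?C. h s t)"
      using h by (intro sum_mono sum_mono2; auto)+
    moreover have "?H r (Suc k) = (\<Sum>s\<in>?A. \<Sum>t\<in>?C. h s t) + (\<Sum>s\<in>?B. \<Sum>t\<in>?C. h s t)"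
      using sum.union_disjoint[of ?A ?B "\<lambda>s. \<Sum>t\<in>?C. h s t"] C by simp
    ultimately show ?thesis by linarith
  qed
  have "(\<integral>x. dyadic (\<lambda>t. Z t x) r (Suc k) \<partial>N) = (\<integral>x. (\<Sum>t\<in>?C. Z t x)\<^sup>2 \<partial>N)
      + (\<integral>x. dyadic (\<lambda>t. Z t x) r k \<partial>N) + (\<integral>x. dyadic (\<lambda>t. Z t x) (r + 2 ^ k) k \<partial>N)"
    using isq[of ?C] Suc[of r] Suc[of "r + 2 ^ k"] by simp
  also have "\<dots> \<le> ?H r (Suc k) + (real k + 1) * ?H r k + (real k + 1) * ?H (r + 2 ^ k) k"
    using esq[of ?C] Suc[of r] Suc[of "r + 2 ^ k"] by (intro add_mono) auto
  also have "\<dots> = ?H r (Suc k) + (real k + 1) * (?H r k + ?H (r + 2 ^ k) k)" by (simp add: algebra_simps)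
  also have "\<dots> \<le> ?H r (Suc k) + (real k + 1) * ?H r (Suc k)"
    using halves by (intro add_left_mono mult_left_mono) auto
  also have "\<dots> = (real (Suc k) + 1) * ?H r (Suc k)" by (simp add: algebra_simps)
  finally show ?case using isq[of ?C] Suc[of r] Suc[of "r + 2 ^ k"] by simp
qed

lemma AE_bounded_of_summable_expectations:
  fixes f :: "nat \<Rightarrow> 'b \<Rightarrow> real"
  assumes int: "\<And>k. integrable N (f k)" and nonneg: "\<And>k x. 0 \<le> f k x"
    and le: "\<And>k. (\<integral>x. f k x \<partial>N) \<le> c k" and sum: "summable c"
  shows "AE x in N. \<exists>C. \<forall>k. f k x \<le> C"
proof -
  have nn: "(\<integral>\<^sup>+x. ennreal (f k x) \<partial>N) = ennreal (\<integral>x. f k x \<partial>N)" for k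
    by (intro nn_integral_eq_integral int) (simp add: nonneg)
  have pos: "0 \<le> (\<integral>x. f k x \<partial>N)" for k using nonneg by simp
  have sm: "summable (\<lambda>k. \<integral>x. f k x \<partial>N)"
    by (rule summable_comparison_test'[OF sum, of 0]) (use le pos in auto)
  have "(\<integral>\<^sup>+x. (\<Sum>k. ennreal (f k x)) \<partial>N) = (\<Sum>k. ennreal (\<integral>x. f k x \<partial>N))"
    using int by (subst nn_integral_suminf) (auto simp: nn)
  also have "\<dots> = ennreal (\<Sum>k. \<integral>x. f k x \<partial>N)" by (rule suminf_ennreal2[OF pos sm])
  finally have "(\<integral>\<^sup>+x. (\<Sum>k. ennreal (f k x)) \<partial>N) \<noteq> \<infinity>" by simp
  hence "AE x in N. (\<Sum>k. ennreal (f k x)) \<noteq> \<infinity>"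
    using int by (intro nn_integral_PInf_AE) auto
  thus ?thesis
  proof eventually_elim
    case (elim x)
    then obtain C where C: "C \<ge> 0" "(\<Sum>k. ennreal (f k x)) = ennreal C" by (cases "(\<Sum>k. ennreal (f k x))") auto
    have "ennreal (f k x) \<le> ennreal C" for k
      unfolding C(2)[symmetric] using sum_le_suminf[of "\<lambda>k. ennreal (f k x)" "{k}"] by simp
    hence "f k x \<le> C" for k using C by (simp add: ennreal_le_iff)
    thus ?case by blast
  qed
qed

section \<open>Truncation and second moments\<close>

context weighted_approximation
begin

lemmas prob_cyl_Q = prob_cyl[folded Q_def]
lemmas prob_cyl_pair_Q = prob_cyl_pair[folded Q_def]

text \<open>
  For \<open>v\<close> dividing \<open>q\<close>, the event that \<open>A\<close> hits \<open>q\<close> and that, moreover, in row \<open>i\<close> the numerator is divisible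
  by \<open>v\<close>: the reduced vector \<open>vdiv q v\<close> is then approximated better by a factor \<open>Q ^ deg v\<close>. The condition
  on \<open>q\<close> in row \<open>i\<close> follows from the one on \<open>vdiv q v\<close> and is therefore replaced by it.
\<close>

definition near :: "'a fls ^ 'n \<Rightarrow> 'a fls \<Rightarrow> 'm \<Rightarrow> ('m \<times> 'n \<Rightarrow> 'a fls) set" where
  "near q v i = cyl ((\<lambda>_. q)(i := vdiv q v)) ((K q)(i := K q i + int (deg v)))"

text \<open>
  The truncated event. Without truncation, the covariances add up to order \<open>T\<^sup>2\<close> for
  \<open>CARD('m) = CARD('n) = 1\<close>.
\<close>

definition kept :: "nat \<Rightarrow> 'a fls ^ 'n \<Rightarrow> ('m \<times> 'n \<Rightarrow> 'a fls) set" where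
  "kept L q = hits q - (\<Union>v\<in>{v \<in> divisors q. L \<le> deg v}. \<Union>i. near q v i)"

text \<open>
  The union bound for the probability that \<open>hits q\<close> is dropped.
\<close>

definition tail :: "nat \<Rightarrow> 'a fls ^ 'n \<Rightarrow> real" where
  "tail L q = (\<Sum>v\<in>{v \<in> divisors q. L \<le> deg v}. real CARD('m) * (density q / Q ^ deg v))"

definition multiples :: "'a fls ^ 'n \<Rightarrow> nat \<Rightarrow> ('a fls ^ 'n) set" where
  "multiples w V = (\<lambda>u. \<chi> j. u * w $ j) ` polys_below (Suc V)"

text \<open>
  The covariance bound for the kept events of proportional \<open>q = u w\<close> and \<open>q' = v w\<close> with \<open>deg u \<le> deg v\<close>. Summing over
  all divisors \<open>v\<close> of \<open>q'\<close>, instead of singling out the reduced one, makes the sum over \<open>q\<close> easy.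
\<close>

definition excess :: "nat \<Rightarrow> 'a fls ^ 'n \<Rightarrow> 'a fls ^ 'n \<Rightarrow> real" where
  "excess L q q' = (\<Sum>v\<in>{v \<in> divisors q'. deg v < L}.
     indicator (multiples (vdiv q' v) (deg v)) q * (density q' / Q ^ deg v))"

lemma sets_hits [measurable]: "hits q \<in> sets M" and sets_near [measurable]: "near q v i \<in> sets M"
  by (simp_all add: hits_def near_def sets_cyl)

lemma denomsD:
  assumes "q \<in> denoms T"
  shows "q \<in> poly_vecs" "q \<noteq> 0" "R < size q" "size q \<le> real T" "0 \<le> K q i" "finite (divisors q)"
  using assms K_nonneg finite_divisors[of q] by (auto simp: denoms_def)

lemma sets_kept [measurable]: "q \<in> denoms T \<Longrightarrow> kept L q \<in> sets M"
proof -
  assume "q \<in> denoms T"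
  hence fin: "finite {v \<in> divisors q. L \<le> deg v}" using denomsD(6)[of q T] by simp
  have "(\<Union>i. near q v i) \<in> sets M" for v by (rule sets.finite_UN) (auto simp: sets_near)
  with fin have "(\<Union>v\<in>{v \<in> divisors q. L \<le> deg v}. \<Union>i. near q v i) \<in> sets M"
    by (intro sets.finite_UN) auto
  thus "kept L q \<in> sets M" unfolding kept_def by (intro sets.Diff sets_hits)
qed

lemma prob_hits: "q \<in> denoms T \<Longrightarrow> measure P (hits q) = density q"
  unfolding hits_def density_def by (rule prob_cyl_Q) (use denomsD[of q T] in auto)

lemma prob_near:
  assumes "q \<in> denoms T" "v \<in> divisors q"
  shows "measure P (near q v i) = density q / Q ^ deg v"
proof -
  have "vdiv q v \<in> poly_vecs" "vdiv q v \<noteq> 0"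
    using assms denomsD(2)[of q T] by (auto simp: divisors_def vdiv_def vec_eq_iff)
  hence "measure P (near q v i)
      = 1 / Q ^ (\<Sum>l\<in>UNIV. nat (((K q)(i := K q i + int (deg v))) l))"
    unfolding near_def using denomsD[of q T] assms by (intro prob_cyl_Q) auto
  also have "(\<Sum>l\<in>UNIV. nat (((K q)(i := K q i + int (deg v))) l)) = (\<Sum>l\<in>UNIV. nat (K q l)) + deg v"
  proof -
    have "(\<Sum>l\<in>UNIV. nat (((K q)(i := K q i + int (deg v))) l))
        = (\<Sum>l\<in>UNIV. nat (K q l) + (if l = i then deg v else 0))"
      using denomsD(5)[OF assms(1)] by (intro sum.cong) (auto simp: nat_add_distrib)
    thus ?thesis by (simp add: sum.distrib)
  qed
  finally show ?thesis by (simp add: density_def power_add)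
qed

lemma prob_dropped:
  assumes "q \<in> denoms T"
  shows "measure P (hits q - kept L q) \<le> tail L q"
proof -
  let ?V = "{v \<in> divisors q. L \<le> deg v}"
  have fin: "finite ?V" using denomsD(6)[OF assms] by simp
  have "measure P (hits q - kept L q) \<le> measure P (\<Union>v\<in>?V. \<Union>i. near q v i)"
    by (intro P.finite_measure_mono) (use fin in \<open>auto simp: kept_def intro!: sets.finite_UN\<close>)
  also have "\<dots> \<le> (\<Sum>v\<in>?V. measure P (\<Union>i. near q v i))"
    by (intro P.finite_measure_subadditive_finite fin) (auto intro!: sets.finite_UN)
  also have "\<dots> \<le> (\<Sum>v\<in>?V. \<Sum>i\<in>UNIV. measure P (near q v i))"
    by (intro sum_mono P.finite_measure_subadditive_finite) auto
  also have "\<dots> = tail L q"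
    using assms by (simp add: tail_def prob_near)
  finally show ?thesis .
qed

lemma tail_nonneg: "0 \<le> tail L q"
  unfolding tail_def using Q_gt_1 density_pos[of q] by (intro sum_nonneg mult_nonneg_nonneg) auto

lemma excess_nonneg: "0 \<le> excess L q q'"
  unfolding excess_def using Q_gt_1 density_pos[of q'] by (intro sum_nonneg mult_nonneg_nonneg) auto

lemma prob_kept_lower:
  assumes "q \<in> denoms T"
  shows "density q - tail L q \<le> measure P (kept L q)"
proof -
  have "measure P (hits q - kept L q) = measure P (hits q) - measure P (kept L q)"
    by (rule P.finite_measure_Diff) (use assms sets_hits sets_kept in simp, use assms sets_kept in simp,
        simp add: kept_def)
  thus ?thesis using prob_dropped[OF assms, of L] prob_hits[OF assms] by simp
qed

text \<open>
  If \<open>deg v\<close> exceeds \<open>K q i\<close> for all \<open>i\<close>, the events are independent. Otherwise \<open>common_approximation\<close> in a row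
  with \<open>deg v \<le> K q i\<close> puts the intersection of the hits into \<open>near q' v i\<close>. For \<open>deg v \<ge> L\<close> this set has been
  removed from \<open>kept L q'\<close>, so nothing remains; for \<open>deg v < L\<close> its probability is a term of the excess.
\<close>

lemma prob_kept_pair_proportional:
  assumes q: "q \<in> denoms T" and q': "q' \<in> denoms T"
    and uv: "u \<in> fls_polys" "v \<in> fls_polys" "\<alpha> \<in> fls_polys" "\<beta> \<in> fls_polys"
    and w: "w \<in> poly_vecs" and nz: "u \<noteq> 0" "v \<noteq> 0" and bez: "\<alpha> * u + \<beta> * v = 1"
    and qw: "\<And>j. q $ j = u * w $ j" "\<And>j. q' $ j = v * w $ j"
    and deg: "fls_subdegree v \<le> fls_subdegree u"
  shows "measure P (kept L q \<inter> kept L q') \<le> density q * density q' + excess L q q'"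
proof -
  note d = denomsD[OF q] and d' = denomsD[OF q']
  have w0: "w \<noteq> 0" using d qw by (auto simp: vec_eq_iff)
  have V: "int (deg v) = - fls_subdegree v" using uv by (simp add: int_deg)
  have "size q \<le> size q'"
  proof -
    have "q $ j = 0 \<or> - real_of_int (fls_subdegree (q $ j)) \<le> real (a (Inr j)) * size q'" for j
    proof (cases "q $ j = 0")
      case False
      hence wj: "w $ j \<noteq> 0" using qw by auto
      hence "fls_subdegree (q' $ j) \<le> fls_subdegree (q $ j)" using nz deg qw by simp
      moreover have "- real_of_int (fls_subdegree (q' $ j)) \<le> real (a (Inr j)) * size q'"
        using size_less_iff(2)[OF d'(2), of "size q'"] wj nz qw by auto
      ultimately show ?thesis by linarith
    qed simp
    thus ?thesis using size_less_iff(2)[OF d(2)] by blast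
  qed
  hence KK: "K q i \<le> K q' i" for i
    unfolding K_def by (intro floor_mono mult_left_mono) auto
  have sub: "kept L q \<inter> kept L q' \<subseteq> hits q \<inter> hits q'" by (auto simp: kept_def)
  show ?thesis
  proof (cases "\<exists>i. int (deg v) \<le> K q i")
    case False
    have less: "K q i < int (deg v)" for i using False not_le by blast
    have onto: "jointly_onto q q' (K q i) (K q' i)" for i
      by (rule jointly_onto_proportional[OF uv nz(2) bez qw w0]) (use less[of i] V in linarith)
    \<comment> \<open>Equality would force \<open>u = v\<close> to be a unit, of degree 0, which belongs to the other case.\<close>
    have "q \<noteq> q'"
    proof
      assume "q = q'"
      moreover obtain j where "w $ j \<noteq> 0" using w0 by (auto simp: vec_eq_iff)
      ultimately have "u = v" using qw[of j] by auto
      hence "(\<alpha> + \<beta>) * v = 1" using bez by (simp add: algebra_simps)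
      moreover have "\<alpha> + \<beta> \<in> fls_polys" using uv by (simp add: fls_polys_add)
      moreover have "\<alpha> + \<beta> \<noteq> 0" using calculation by auto
      ultimately have "fls_subdegree (\<alpha> + \<beta>) + fls_subdegree v = 0"
        using nz by (metis fls_subdegree_mult fls_one_subdegree)
      hence "int (deg v) = 0" 
        using fls_subdegree_poly_nonpos[of "\<alpha> + \<beta>"] \<open>\<alpha> + \<beta> \<in> fls_polys\<close> V by linarith
      thus False using False d(5) by auto
    qed
    hence "measure P (hits q \<inter> hits q') = density q * density q'"
      unfolding hits_def density_def using d d' onto by (intro prob_cyl_pair_Q) auto
    moreover have "measure P (kept L q \<inter> kept L q') \<le> measure P (hits q \<inter> hits q')"
      by (intro P.finite_measure_mono sub) auto
    ultimately show ?thesis using excess_nonneg[of L q q'] by linarith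
  next
    case True
    then obtain i where i: "int (deg v) \<le> K q i" by blast
    have vw: "vdiv q' v = w" using qw nz by (simp add: vdiv_def vec_eq_iff)
    have v: "v \<in> divisors q'" using uv nz w by (simp add: divisors_def vw)
    have sub': "hits q \<inter> hits q' \<subseteq> near q' v i"
    proof
      fix x assume x: "x \<in> hits q \<inter> hits q'"
      have e: "u * dot x i w = dot x i q" "v * dot x i w = dot x i q'"
        by (simp_all add: dot_def qw sum_distrib_left mult_ac)
      have "\<forall>n\<in>{1..K q' i - fls_subdegree v}. dot x i w $$ n = 0"
        using x KK i V
        by (intro common_approximation[OF uv nz bez deg, of "K q i"]) (auto simp: e hits_def cyl_def)
      thus "x \<in> near q' v i" using x V by (auto simp: near_def hits_def cyl_def vw)
    qed
    show ?thesis
    proof (cases "deg v < L")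
      case False
      hence "kept L q \<inter> kept L q' = {}" using v sub' sub by (auto simp: kept_def not_less)
      thus ?thesis using excess_nonneg[of L q q'] density_pos[of q] density_pos[of q'] by simp
    next
      case True
      have "measure P (kept L q \<inter> kept L q') \<le> measure P (near q' v i)"
        using sub sub' by (intro P.finite_measure_mono) auto
      also have "\<dots> = density q' / Q ^ deg v" by (rule prob_near[OF q' v])
      also have "\<dots> \<le> excess L q q'"
      proof -
        have "u \<in> polys_below (Suc (deg v))"
          using uv deg int_deg[of u] V by (auto simp: in_polys_below_iff)
        hence "q \<in> multiples (vdiv q' v) (deg v)"
          unfolding multiples_def vw using qw by (intro image_eqI[of _ _ u]) (auto simp: vec_eq_iff)
        hence "density q' / Q ^ deg v = indicator (multiples (vdiv q' v) (deg v)) q * (density q' / Q ^ deg v)"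
          by simp
        also have "\<dots> \<le> excess L q q'"
          unfolding excess_def using d'(6) v True Q_gt_1 density_pos[of q']
          by (intro member_le_sum mult_nonneg_nonneg) auto
        finally show ?thesis .
      qed
      finally show ?thesis using mult_pos_pos[OF density_pos[of q] density_pos[of q']] by linarith
    qed
  qed
qed

lemma prob_kept_pair:
  assumes q: "q \<in> denoms T" and q': "q' \<in> denoms T"
  shows "measure P (kept L q \<inter> kept L q') \<le> density q * density q' + excess L q q' + excess L q' q"
proof (cases "\<forall>i j. q $ i * q' $ j = q $ j * q' $ i")
  case False
  then obtain i j where ij: "q $ i * q' $ j \<noteq> q $ j * q' $ i" by blast
  hence "q \<noteq> q'" by (auto simp: mult.commute)
  hence "measure P (hits q \<inter> hits q') = density q * density q'"
    unfolding hits_def density_def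
    using denomsD[OF q] denomsD[OF q'] jointly_onto_independent[OF ij] by (intro prob_cyl_pair_Q) auto
  moreover have "measure P (kept L q \<inter> kept L q') \<le> measure P (hits q \<inter> hits q')"
    by (intro P.finite_measure_mono) (auto simp: kept_def)
  ultimately show ?thesis using excess_nonneg[of L q q'] excess_nonneg[of L q' q] by linarith
next
  case True
  show ?thesis
  proof (rule proportional_poly_vecs[of q q'])
    show "q \<in> poly_vecs" "q' \<in> poly_vecs" "q \<noteq> 0" "q' \<noteq> 0"
      using denomsD[OF q] denomsD[OF q'] by auto
    show "q $ i * q' $ j = q $ j * q' $ i" for i j using True by blast
    fix u v \<alpha> \<beta> :: "'a fls" and w :: "'a fls ^ 'n"
    assume uv: "u \<in> fls_polys" "v \<in> fls_polys" "\<alpha> \<in> fls_polys" "\<beta> \<in> fls_polys"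
      "w \<in> poly_vecs" "u \<noteq> 0" "v \<noteq> 0" "\<alpha> * u + \<beta> * v = 1"
      "\<And>j. q $ j = u * w $ j" "\<And>j. q' $ j = v * w $ j"
  show ?thesis
  proof (cases "fls_subdegree v \<le> fls_subdegree u")
    case True
    from prob_kept_pair_proportional[OF q q' uv True, of L] show ?thesis
      using excess_nonneg[of L q' q] by linarith
  next
    case False
    have "\<beta> * v + \<alpha> * u = 1" using uv(8) by (simp add: add.commute)
    from prob_kept_pair_proportional[OF q' q uv(2,1,4,3,5,7,6) this uv(10,9), of L] False
    show ?thesis using excess_nonneg[of L q q'] by (simp add: Int_commute mult.commute)
  qed
  qed
qed

end

lemma geometric_tail_le: "(\<Sum>V\<in>{L..B}. (1 / 2 :: real) ^ V) \<le> 2 * (1 / 2) ^ L"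
proof (cases "L \<le> B")
  case True
  have "(\<Sum>V\<in>{L..B}. (1 / 2 :: real) ^ V) = 2 * (1 / 2) ^ L - (1 / 2) ^ B"
    using True by (induction B rule: dec_induct) auto
  thus ?thesis by simp
qed simp

context weighted_approximation
begin

text \<open>
  Grouping by the degree of the divisor and applying \<open>sum_divisor_pairs\<close> to each degree.
\<close>

lemma sum_over_divisors:
  assumes c: "\<And>V. 0 \<le> c V" and "finite I"
  shows "(\<Sum>q\<in>denoms T. \<Sum>v\<in>{v \<in> divisors q. deg v \<in> I}. c (deg v) * density q)
    \<le> (\<Sum>V\<in>I. c V) * (C0 * (real T + 1))"
proof -
  let ?S = "SIGMA q:denoms T. {v \<in> divisors q. deg v \<in> I}"
  have fin: "finite ?S" using denomsD(6) by (intro finite_SigmaI) auto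
  have "(\<Sum>q\<in>denoms T. \<Sum>v\<in>{v \<in> divisors q. deg v \<in> I}. c (deg v) * density q)
      = (\<Sum>(q, v)\<in>?S. c (deg v) * density q)"
    using denomsD(6) by (intro sum.Sigma) auto
  also have "\<dots> = (\<Sum>V\<in>I. \<Sum>(q, v)\<in>{t \<in> ?S. deg (snd t) = V}. c (deg v) * density q)"
    using fin \<open>finite I\<close> by (intro sum.group[symmetric]) auto
  also have "\<dots> \<le> (\<Sum>V\<in>I. c V * (C0 * (real T + 1)))"
  proof (rule sum_mono)
    fix V assume "V \<in> I"
    have "(\<Sum>(q, v)\<in>{t \<in> ?S. deg (snd t) = V}. c (deg v) * density q)
        = (\<Sum>(q, v)\<in>{(q, v). q \<in> denoms T \<and> v \<in> divisors q \<and> deg v = V}. c V * density q)"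
      using \<open>V \<in> I\<close> by (intro sum.cong) auto
    also have "\<dots> = c V * (\<Sum>(q, v)\<in>{(q, v). q \<in> denoms T \<and> v \<in> divisors q \<and> deg v = V}. density q)"
      by (simp add: sum_distrib_left case_prod_unfold)
    also have "\<dots> \<le> c V * (C0 * (real T + 1))"
      by (intro mult_left_mono sum_divisor_pairs c)
    finally show "(\<Sum>(q, v)\<in>{t \<in> ?S. deg (snd t) = V}. c (deg v) * density q) \<le> c V * (C0 * (real T + 1))" .
  qed
  finally show ?thesis by (simp add: sum_distrib_right)
qed

lemma sum_tail: "(\<Sum>q\<in>denoms T. tail L q) \<le> 2 * real CARD('m) * C0 * (real T + 1) * (1 / 2) ^ L"
proof -
  have "finite (\<Union>q\<in>denoms T. deg ` divisors q)" using denomsD(6) by auto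
  then obtain B where B: "\<And>q v. q \<in> denoms T \<Longrightarrow> v \<in> divisors q \<Longrightarrow> deg v \<le> B"
    unfolding finite_nat_set_iff_bounded_le by blast
  have "(\<Sum>q\<in>denoms T. tail L q)
      = (\<Sum>q\<in>denoms T. \<Sum>v\<in>{v \<in> divisors q. deg v \<in> {L..B}}. (real CARD('m) / Q ^ deg v) * density q)"
    unfolding tail_def using B by (intro sum.cong) auto
  also have "\<dots> \<le> (\<Sum>V\<in>{L..B}. real CARD('m) / Q ^ V) * (C0 * (real T + 1))"
    using Q_gt_1 by (intro sum_over_divisors) auto
  also have "\<dots> \<le> (real CARD('m) * (2 * (1 / 2) ^ L)) * (C0 * (real T + 1))"
  proof (rule mult_right_mono)
    have "(\<Sum>V\<in>{L..B}. real CARD('m) / Q ^ V) \<le> (\<Sum>V\<in>{L..B}. real CARD('m) * (1 / 2) ^ V)"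
      using Q_ge_2 by (intro sum_mono) (auto simp: power_one_over field_simps intro!: power_mono)
    also have "\<dots> \<le> real CARD('m) * (2 * (1 / 2) ^ L)"
      unfolding sum_distrib_left[symmetric] by (intro mult_left_mono geometric_tail_le) auto
    finally show "(\<Sum>V\<in>{L..B}. real CARD('m) / Q ^ V) \<le> real CARD('m) * (2 * (1 / 2) ^ L)" .
  qed (use C0_pos in auto)
  finally show ?thesis by (simp add: mult_ac)
qed

text \<open>
  The \<open>Q ^ (deg v + 1)\<close> multiples \<open>u\<close> compensate the factor \<open>Q ^ deg v\<close> in the denominator, so every degree below
  \<open>L\<close> contributes the same amount.
\<close>

lemma sum_excess: "(\<Sum>q\<in>denoms T. \<Sum>q'\<in>denoms T. excess L q q') \<le> Q * real L * (C0 * (real T + 1))"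
proof -
  have "(\<Sum>q\<in>denoms T. \<Sum>q'\<in>denoms T. excess L q q') = (\<Sum>q'\<in>denoms T. \<Sum>q\<in>denoms T. excess L q q')"
    by (rule sum.swap)
  also have "\<dots> \<le> (\<Sum>q'\<in>denoms T. \<Sum>v\<in>{v \<in> divisors q'. deg v \<in> {..<L}}. Q * density q')"
  proof (rule sum_mono)
    fix q' assume q': "q' \<in> denoms T"
    let ?m = "\<lambda>v. multiples (vdiv q' v) (deg v)"
    have "(\<Sum>q\<in>denoms T. excess L q q') = (\<Sum>v\<in>{v \<in> divisors q'. deg v < L}. \<Sum>q\<in>denoms T.
       indicator (?m v) q * (density q' / Q ^ deg v))"
      unfolding excess_def by (rule sum.swap)
    also have "\<dots> \<le> (\<Sum>v\<in>{v \<in> divisors q'. deg v < L}. Q * density q')"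
    proof (rule sum_mono)
      fix v
      have fin: "finite (?m v)" by (simp add: multiples_def)
      have "card (denoms T \<inter> ?m v) \<le> card (?m v)" by (intro card_mono fin) auto
      also have "\<dots> \<le> card (polys_below (Suc (deg v)) :: 'a fls set)"
        unfolding multiples_def by (rule card_image_le) simp
      also have "\<dots> = CARD('a) ^ Suc (deg v)" by (simp add: card_polys_below)
      finally have "real (card (denoms T \<inter> ?m v)) \<le> real (CARD('a) ^ Suc (deg v))" by (rule of_nat_mono)
      hence card: "real (card (denoms T \<inter> ?m v)) \<le> Q * Q ^ deg v" by (simp add: Q_def)
      have "real (card (denoms T \<inter> ?m v)) = (\<Sum>q\<in>denoms T \<inter> ?m v. 1)" by simp
      also have "\<dots> = (\<Sum>q\<in>denoms T. if q \<in> ?m v then 1 else 0)" by (rule sum.inter_restrict) simp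
      also have "\<dots> = (\<Sum>q\<in>denoms T. indicator (?m v) q)" by (intro sum.cong) (auto simp: indicator_def)
      finally have "(\<Sum>q\<in>denoms T. indicator (?m v) q * (density q' / Q ^ deg v))
          = real (card (denoms T \<inter> ?m v)) * (density q' / Q ^ deg v)"
        by (simp only: sum_distrib_right)
      also have "\<dots> \<le> Q * Q ^ deg v * (density q' / Q ^ deg v)"
        using Q_gt_1 density_pos[of q'] by (intro mult_right_mono card) auto
      also have "\<dots> = Q * density q'" using Q_gt_1 by simp
      finally show "(\<Sum>q\<in>denoms T. indicator (?m v) q * (density q' / Q ^ deg v)) \<le> Q * density q'" .
    qed
    finally show "(\<Sum>q\<in>denoms T. excess L q q') \<le> (\<Sum>v\<in>{v \<in> divisors q'. deg v \<in> {..<L}}. Q * density q')"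
      by simp
  qed
  also have "\<dots> \<le> (\<Sum>V\<in>{..<L}. Q) * (C0 * (real T + 1))"
    using Q_gt_1 by (intro sum_over_divisors) auto
  finally show ?thesis by (simp add: mult_ac)
qed

definition Z :: "nat \<Rightarrow> 'a fls ^ 'n \<Rightarrow> ('m \<times> 'n \<Rightarrow> 'a fls) \<Rightarrow> real" where
  "Z L q x = indicator (kept L q) x - density q"

text \<open>
  An upper bound for the expectation of \<open>Z L q x * Z L q' x\<close>; the last two terms account for
  centring at \<open>density\<close> instead of at the slightly smaller probability of \<open>kept\<close>.
\<close>

definition cov :: "nat \<Rightarrow> 'a fls ^ 'n \<Rightarrow> 'a fls ^ 'n \<Rightarrow> real" where
  "cov L q q' = excess L q q' + excess L q' q + density q' * tail L q + density q * tail L q'"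

lemma cov_nonneg: "0 \<le> cov L q q'"
  unfolding cov_def using excess_nonneg tail_nonneg density_pos
  by (intro add_nonneg_nonneg mult_nonneg_nonneg less_imp_le[OF density_pos]) auto

lemma integrable_indicator_P: "S \<in> sets M \<Longrightarrow> integrable P (indicator S :: _ \<Rightarrow> real)"
  by (simp add: P.emeasure_eq_measure)

lemma expectation_Z:
  assumes q: "q \<in> denoms T" and q': "q' \<in> denoms T"
  shows "integrable P (\<lambda>x. Z L q x * Z L q' x)"
    and "(\<integral>x. Z L q x * Z L q' x \<partial>P) \<le> cov L q q'"
proof -
  have Z: "Z L q x * Z L q' x = indicator (kept L q \<inter> kept L q') x - density q' * indicator (kept L q) x
      - density q * indicator (kept L q') x + density q * density q'" for x
    by (simp add: Z_def indicator_inter_arith algebra_simps)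
  have s: "kept L q \<in> sets M" "kept L q' \<in> sets M" "kept L q \<inter> kept L q' \<in> sets M"
    using sets_kept[OF q] sets_kept[OF q'] by auto
  have i: "integrable P (indicator (kept L q \<inter> kept L q') :: _ \<Rightarrow> real)"
    "integrable P (\<lambda>x. density q' * indicator (kept L q) x)"
    "integrable P (\<lambda>x. density q * indicator (kept L q') x)"
    by (intro integrable_mult_right integrable_indicator_P s)+
  show "integrable P (\<lambda>x. Z L q x * Z L q' x)" unfolding Z using i by simp
  have "(\<integral>x. Z L q x * Z L q' x \<partial>P) = measure P (kept L q \<inter> kept L q')
      - density q' * measure P (kept L q) - density q * measure P (kept L q') + density q * density q'"
    unfolding Z using i s P.prob_space by simp
  moreover have "density q' * (density q - tail L q) \<le> density q' * measure P (kept L q)"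
    by (intro mult_left_mono prob_kept_lower[OF q] less_imp_le[OF density_pos])
  moreover have "density q * (density q' - tail L q') \<le> density q * measure P (kept L q')"
    by (intro mult_left_mono prob_kept_lower[OF q'] less_imp_le[OF density_pos])
  ultimately show "(\<integral>x. Z L q x * Z L q' x \<partial>P) \<le> cov L q q'"
    using prob_kept_pair[OF q q', of L] unfolding cov_def right_diff_distrib
    by (simp only: mult.commute[of "density q'" "density q"])
qed

definition C1 :: real where "C1 = 8 * Q * C0 + 16 * real CARD('m) * C0 * C0"

lemma sum_cov: "(\<Sum>q\<in>denoms (2 ^ k). \<Sum>q'\<in>denoms (2 ^ k). cov (2 * k) q q') \<le> C1 * (real k + 1) * 2 ^ k"
proof -
  let ?T = "2 ^ k :: nat" and ?L = "2 * k" and ?m = "real CARD('m)"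
  let ?E = "\<Sum>q\<in>denoms ?T. \<Sum>q'\<in>denoms ?T. excess ?L q q'" and ?B = "\<Sum>q\<in>denoms ?T. tail ?L q"
  \<comment> \<open>With \<open>L = 2 k\<close> the factor \<open>(1 / 2) ^ L\<close> of the tails cancels the square of \<open>T = 2 ^ k\<close>.\<close>
  have "(\<Sum>q\<in>denoms ?T. \<Sum>q'\<in>denoms ?T. cov ?L q q') = 2 * ?E + 2 * (main_term ?T * ?B)"
  proof -
    have "(\<Sum>q\<in>denoms ?T. \<Sum>q'\<in>denoms ?T. excess ?L q' q) = ?E" by (rule sum.swap)
    moreover have "(\<Sum>q\<in>denoms ?T. \<Sum>q'\<in>denoms ?T. density q' * tail ?L q) = main_term ?T * ?B"
      unfolding main_term_def sum_product by (rule sum.swap)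
    moreover have "(\<Sum>q\<in>denoms ?T. \<Sum>q'\<in>denoms ?T. density q * tail ?L q') = main_term ?T * ?B"
      unfolding main_term_def sum_product ..
    ultimately show ?thesis by (simp add: cov_def sum.distrib)
  qed
  moreover have "?E \<le> 4 * Q * C0 * (real k + 1) * 2 ^ k"
  proof -
    have "?E \<le> Q * real ?L * (C0 * (real ?T + 1))" by (rule sum_excess)
    also have "\<dots> \<le> Q * (2 * (real k + 1)) * (C0 * (2 * 2 ^ k))"
      using Q_gt_1 C0_pos by (intro mult_mono mult_nonneg_nonneg) auto
    finally show ?thesis by (simp add: algebra_simps)
  qed
  moreover have "main_term ?T * ?B \<le> 8 * ?m * C0 * C0"
  proof -
    have "main_term ?T \<le> C0 * (2 * 2 ^ k)"
      using C0_pos by (intro order_trans[OF main_term_upper] mult_left_mono) auto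
    moreover have "?B \<le> 2 * ?m * C0 * (2 * 2 ^ k) * (1 / 2) ^ ?L"
      using C0_pos by (intro order_trans[OF sum_tail] mult_right_mono mult_left_mono) auto
    ultimately have "main_term ?T * ?B \<le> (C0 * (2 * 2 ^ k)) * (2 * ?m * C0 * (2 * 2 ^ k) * (1 / 2) ^ ?L)"
      using C0_pos by (intro mult_mono) (auto intro!: sum_nonneg tail_nonneg)
    also have "\<dots> = 8 * ?m * C0 * C0 * ((2 ^ k * 2 ^ k) * (1 / 2) ^ ?L)" by (simp add: mult_ac)
    also have "(2 ^ k * 2 ^ k) * (1 / 2 :: real) ^ ?L = 1"
      by (simp add: mult_2 power_add power_one_over)
    finally show ?thesis by simp
  qed
  moreover have "8 * ?m * C0 * C0 * 1 \<le> 8 * ?m * C0 * C0 * ((real k + 1) * 2 ^ k)"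
    using C0_pos mult_mono[of 1 "real k + 1" 1 "2 ^ k"] by (intro mult_left_mono) auto
  ultimately have "(\<Sum>q\<in>denoms ?T. \<Sum>q'\<in>denoms ?T. cov ?L q q')
      \<le> 2 * (4 * Q * C0 * (real k + 1) * 2 ^ k) + 2 * (8 * ?m * C0 * C0 * ((real k + 1) * 2 ^ k))" by linarith
  also have "\<dots> = C1 * (real k + 1) * 2 ^ k" by (simp add: C1_def algebra_simps)
  finally show ?thesis .
qed

lemma denoms_mono: "T \<le> T' \<Longrightarrow> denoms T \<subseteq> denoms T'"
proof -
  assume "T \<le> T'"
  hence "real T \<le> real T'" by simp
  thus "denoms T \<subseteq> denoms T'" unfolding denoms_def by auto
qed

text \<open>
  The denominators are grouped by \<open>\<lceil>size q\<rceil>\<close>, which is positive because \<open>size q > R > 0\<close>; the shift by one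
  makes the levels start at 0.
\<close>

definition level :: "nat \<Rightarrow> nat \<Rightarrow> ('a fls ^ 'n) set" where
  "level k t = {q \<in> denoms (2 ^ k). nat \<lceil>size q\<rceil> = Suc t}"

definition block :: "nat \<Rightarrow> nat \<Rightarrow> ('m \<times> 'n \<Rightarrow> 'a fls) \<Rightarrow> real" where
  "block k t x = (\<Sum>q\<in>level k t. Z (2 * k) q x)"

lemma sum_levels:
  fixes f :: "'a fls ^ 'n \<Rightarrow> real"
  assumes "T \<le> 2 ^ k"
  shows "(\<Sum>t\<in>{0..<T}. \<Sum>q\<in>level k t. f q) = (\<Sum>q\<in>denoms T. f q)"
proof -
  have pos: "1 \<le> nat \<lceil>size q\<rceil>" if "q \<in> denoms T'" for q T'
    using denomsD(3)[OF that] R by (simp add: Suc_le_eq)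
  have le: "nat \<lceil>size q\<rceil> \<le> T' \<longleftrightarrow> size q \<le> real T'" for q T'
    by (simp add: nat_le_iff ceiling_le_iff)
  have "(\<Sum>t\<in>{0..<T}. \<Sum>q\<in>{q \<in> denoms T. nat \<lceil>size q\<rceil> - 1 = t}. f q) = (\<Sum>q\<in>denoms T. f q)"
  proof (rule sum.group)
    show "(\<lambda>q. nat \<lceil>size q\<rceil> - 1) ` denoms T \<subseteq> {0..<T}"
    proof
      fix t assume "t \<in> (\<lambda>q. nat \<lceil>size q\<rceil> - 1) ` denoms T"
      then obtain q where "q \<in> denoms T" "t = nat \<lceil>size q\<rceil> - 1" by blast
      moreover from this have "nat \<lceil>size q\<rceil> \<le> T" using denomsD(4)[of q T] by (simp only: le)
      ultimately have "t < T" using pos[of q T] by linarith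
      thus "t \<in> {0..<T}" by simp
    qed
  qed auto
  moreover have "level k t = {q \<in> denoms T. nat \<lceil>size q\<rceil> - 1 = t}" if "t < T" for t
  proof (intro set_eqI iffI)
    fix q assume q: "q \<in> level k t"
    hence "nat \<lceil>size q\<rceil> \<le> T" using that by (simp add: level_def)
    hence "size q \<le> real T" by (simp only: le)
    thus "q \<in> {q \<in> denoms T. nat \<lceil>size q\<rceil> - 1 = t}" using q by (auto simp: level_def denoms_def)
  next
    fix q assume q: "q \<in> {q \<in> denoms T. nat \<lceil>size q\<rceil> - 1 = t}"
    hence "q \<in> denoms (2 ^ k)" using denoms_mono[OF assms] by auto
    thus "q \<in> level k t" using q pos[of q T] by (auto simp: level_def)
  qed
  ultimately show ?thesis by simp
qed

text \<open>
  One factor \<open>k + 1\<close> comes from \<open>dyadic_expectation\<close>, the other from the truncation degree in \<open>sum_cov\<close>.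
\<close>

lemma second_moment:
  shows "integrable P (\<lambda>x. dyadic (\<lambda>t. block k t x) 0 k)"
    and "(\<integral>x. dyadic (\<lambda>t. block k t x) 0 k \<partial>P) \<le> C1 * (real k + 1)\<^sup>2 * 2 ^ k"
proof -
  let ?h = "\<lambda>s t. \<Sum>q\<in>level k s. \<Sum>q'\<in>level k t. cov (2 * k) q q'"
  have prod: "block k s x * block k t x = (\<Sum>q\<in>level k s. \<Sum>q'\<in>level k t. Z (2 * k) q x * Z (2 * k) q' x)" for s t x
    by (simp add: block_def sum_product)
  have lev: "q \<in> denoms (2 ^ k)" if "q \<in> level k t" for q t using that by (simp add: level_def)
  have int: "integrable P (\<lambda>x. block k s x * block k t x)" for s t
    unfolding prod by (intro Bochner_Integration.integrable_sum expectation_Z(1)[OF lev lev])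
  have exp: "(\<integral>x. block k s x * block k t x \<partial>P) \<le> ?h s t" for s t
  proof -
    have "(\<integral>x. block k s x * block k t x \<partial>P)
        = (\<Sum>q\<in>level k s. \<Sum>q'\<in>level k t. \<integral>x. Z (2 * k) q x * Z (2 * k) q' x \<partial>P)"
      unfolding prod
      by (subst Bochner_Integration.integral_sum, intro Bochner_Integration.integrable_sum expectation_Z(1)[OF lev lev],
          assumption, assumption, intro sum.cong refl Bochner_Integration.integral_sum expectation_Z(1)[OF lev lev])
    also have "\<dots> \<le> ?h s t" by (intro sum_mono expectation_Z(2)[OF lev lev])
    finally show ?thesis .
  qed
  have "0 \<le> ?h s t" for s t by (intro sum_nonneg cov_nonneg)
  note * = dyadic_expectation[where Z = "block k" and h = ?h, OF int exp this, of 0 k]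
  show "integrable P (\<lambda>x. dyadic (\<lambda>t. block k t x) 0 k)" using * by blast
  have "(\<Sum>s\<in>{0..<2 ^ k}. \<Sum>t\<in>{0..<2 ^ k}. ?h s t) = (\<Sum>q\<in>denoms (2 ^ k). \<Sum>q'\<in>denoms (2 ^ k). cov (2 * k) q q')"
  proof -
    have "(\<Sum>s\<in>{0..<2 ^ k}. \<Sum>t\<in>{0..<2 ^ k}. ?h s t)
        = (\<Sum>s\<in>{0..<2 ^ k}. \<Sum>q\<in>level k s. \<Sum>t\<in>{0..<2 ^ k}. \<Sum>q'\<in>level k t. cov (2 * k) q q')"
      by (intro sum.cong refl sum.swap)
    also have "\<dots> = (\<Sum>q\<in>denoms (2 ^ k). \<Sum>t\<in>{0..<2 ^ k}. \<Sum>q'\<in>level k t. cov (2 * k) q q')"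
      by (rule sum_levels) simp
    finally show ?thesis by (simp add: sum_levels)
  qed
  also have "\<dots> \<le> C1 * (real k + 1) * 2 ^ k" by (rule sum_cov)
  finally have "(real k + 1) * (\<Sum>s\<in>{0..<2 ^ k}. \<Sum>t\<in>{0..<2 ^ k}. ?h s t) \<le> (real k + 1) * (C1 * (real k + 1) * 2 ^ k)"
    by (intro mult_left_mono) auto
  thus "(\<integral>x. dyadic (\<lambda>t. block k t x) 0 k \<partial>P) \<le> C1 * (real k + 1)\<^sup>2 * 2 ^ k"
    using order_trans[OF conjunct2[OF *]] by (simp add: power2_eq_square mult_ac)
qed

definition lost :: "nat \<Rightarrow> ('m \<times> 'n \<Rightarrow> 'a fls) \<Rightarrow> real" where
  "lost k x = (\<Sum>q\<in>denoms (2 ^ k). indicator (hits q - kept (2 * k) q) x)"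

lemma lost_nonneg: "0 \<le> lost k x"
  unfolding lost_def by (intro sum_nonneg) auto

lemma expectation_lost:
  shows "integrable P (lost k)" "(\<integral>x. lost k x \<partial>P) \<le> 4 * real CARD('m) * C0 * (1 / 2) ^ k"
proof -
  have s: "hits q - kept (2 * k) q \<in> sets M" if "q \<in> denoms (2 ^ k)" for q
    using sets_hits sets_kept[OF that] by blast
  show "integrable P (lost k)"
    unfolding lost_def by (intro Bochner_Integration.integrable_sum integrable_indicator_P s)
  have "(\<integral>x. lost k x \<partial>P) = (\<Sum>q\<in>denoms (2 ^ k). measure P (hits q - kept (2 * k) q))"
    unfolding lost_def using s
    by (subst Bochner_Integration.integral_sum) (auto intro: integrable_indicator_P)
  also have "\<dots> \<le> (\<Sum>q\<in>denoms (2 ^ k). tail (2 * k) q)"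
    by (intro sum_mono prob_dropped)
  also have "\<dots> \<le> 2 * real CARD('m) * C0 * (2 * 2 ^ k) * (1 / 2) ^ (2 * k)"
    using C0_pos by (intro order_trans[OF sum_tail] mult_right_mono mult_left_mono) auto
  also have "\<dots> = 4 * real CARD('m) * C0 * (2 ^ k * (1 / 2) ^ (2 * k))" by simp
  also have "2 ^ k * (1 / 2 :: real) ^ (2 * k) = (1 / 2) ^ k"
    by (simp add: mult_2 power_add power_one_over)
  finally show "(\<integral>x. lost k x \<partial>P) \<le> 4 * real CARD('m) * C0 * (1 / 2) ^ k" .
qed

lemma summable_powr_Suc: "e < - 1 \<Longrightarrow> summable (\<lambda>k. (real k + 1) powr e)"
  using summable_Suc_iff[of "\<lambda>k. real k powr e"] summable_real_powr_iff[of e] by (simp add: add.commute)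

definition discrepancy :: "nat \<Rightarrow> ('m \<times> 'n \<Rightarrow> 'a fls) \<Rightarrow> real" where
  "discrepancy T x = (\<Sum>q\<in>denoms T. indicator (hits q) x) - main_term T"

lemma discrepancy_bound:
  assumes "T \<le> 2 ^ k"
  shows "\<bar>discrepancy T x\<bar> \<le> sqrt ((real k + 1) * dyadic (\<lambda>t. block k t x) 0 k) + lost k x"
proof -
  have "indicator (hits q) x = Z (2 * k) q x + density q + indicator (hits q - kept (2 * k) q) x" for q
    by (auto simp: Z_def kept_def indicator_def)
  hence "discrepancy T x = (\<Sum>q\<in>denoms T. Z (2 * k) q x) + (\<Sum>q\<in>denoms T. indicator (hits q - kept (2 * k) q) x)"
    by (simp add: discrepancy_def main_term_def sum.distrib)
  moreover have "(\<Sum>q\<in>denoms T. Z (2 * k) q x) = (\<Sum>t\<in>{0..<0 + T}. block k t x)"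
    using sum_levels[OF assms] by (simp add: block_def)
  moreover have "\<bar>\<Sum>t\<in>{0..<0 + T}. block k t x\<bar> \<le> sqrt ((real k + 1) * dyadic (\<lambda>t. block k t x) 0 k)"
    by (rule real_le_rsqrt) (use partial_sum_le_dyadic[OF assms, of "\<lambda>t. block k t x" 0] in simp)
  moreover have "(\<Sum>q\<in>denoms T. indicator (hits q - kept (2 * k) q) x) \<le> lost k x"
  proof -
    show ?thesis unfolding lost_def using denoms_mono[OF assms] by (intro sum_mono2) auto
  qed
  moreover have "0 \<le> (\<Sum>q\<in>denoms T. indicator (hits q - kept (2 * k) q) x :: real)"
    by (intro sum_nonneg) auto
  ultimately show ?thesis by linarith
qed

text \<open>
  Dividing the \<open>k\<close>-th second moment by \<open>2\<^sup>k (k + 1)\<^sup>3\<^sup>+\<^sup>2\<^sup>\<epsilon>\<close> leaves the summable \<open>(k + 1)\<^sup>-\<^sup>1\<^sup>-\<^sup>2\<^sup>\<epsilon>\<close>, so almost surely the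
  dyadic sums are bounded by a multiple of the divisor. The maximal inequality costs one more factor
  \<open>k + 1\<close>, and the square root of the product is \<open>2\<^sup>k\<^sup>/\<^sup>2 (k + 1)\<^sup>2\<^sup>+\<^sup>\<epsilon>\<close>.
\<close>

lemma AE_discrepancy_cube:
  assumes "\<epsilon> > 0"
  shows "AE x in P. \<exists>C. \<forall>k T. T \<le> 2 ^ k \<longrightarrow>
    \<bar>discrepancy T x\<bar> \<le> C * sqrt (2 ^ k) * (real k + 1) powr (2 + \<epsilon>)"
proof -
  define e where "e = 3 + 2 * \<epsilon>"
  define f where "f k x = dyadic (\<lambda>t. block k t x) 0 k / (2 ^ k * (real k + 1) powr e)" for k x
  have f0: "0 \<le> f k x" for k x by (simp add: f_def dyadic_nonneg)
  have "AE x in P. \<exists>C. \<forall>k. f k x \<le> C"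
  proof (rule AE_bounded_of_summable_expectations)
    fix k
    show "integrable P (f k)" unfolding f_def using second_moment(1)[of k] by simp
    have "(\<integral>x. f k x \<partial>P) = (\<integral>x. dyadic (\<lambda>t. block k t x) 0 k \<partial>P) / (2 ^ k * (real k + 1) powr e)"
      unfolding f_def by simp
    also have "\<dots> \<le> C1 * (real k + 1)\<^sup>2 * 2 ^ k / (2 ^ k * (real k + 1) powr e)"
      by (intro divide_right_mono second_moment) auto
    also have "\<dots> = C1 * ((real k + 1) powr 2 / (real k + 1) powr e)" by (simp add: powr_numeral)
    also have "\<dots> = C1 * (real k + 1) powr (2 - e)" by (simp only: powr_diff)
    finally show "(\<integral>x. f k x \<partial>P) \<le> C1 * (real k + 1) powr (2 - e)" .
  qed (use f0 assms in \<open>auto simp: e_def intro!: summable_mult summable_powr_Suc\<close>)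
  moreover have "AE x in P. \<exists>C. \<forall>k. lost k x \<le> C"
    by (rule AE_bounded_of_summable_expectations[where c = "\<lambda>k. 4 * real CARD('m) * C0 * (1 / 2) ^ k"])
       (auto intro!: expectation_lost summable_mult summable_geometric lost_nonneg)
  ultimately show ?thesis
  proof eventually_elim
    case (elim x)
    obtain C where C: "f k x \<le> C" for k using elim by blast
    obtain C' where C': "lost k x \<le> C'" for k using elim by blast
    have C0: "0 \<le> C" using f0[of 0 x] C[of 0] by simp
    have C'0: "0 \<le> C'" using C'[of 0] lost_nonneg[of 0 x] by linarith
    have "\<bar>discrepancy T x\<bar> \<le> (sqrt C + C') * sqrt (2 ^ k) * (real k + 1) powr (2 + \<epsilon>)" if "T \<le> 2 ^ k" for k T
    proof -
      let ?b = "sqrt (2 ^ k) * (real k + 1) powr (2 + \<epsilon>)"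
      have "(real k + 1) * dyadic (\<lambda>t. block k t x) 0 k = (real k + 1) * (f k x * (2 ^ k * (real k + 1) powr e))"
        by (simp add: f_def)
      also have "\<dots> \<le> (real k + 1) * (C * (2 ^ k * (real k + 1) powr e))"
        using C by (intro mult_left_mono mult_right_mono) auto
      also have "\<dots> = C * (2 ^ k * ((real k + 1) powr 1 * (real k + 1) powr e))" by simp
      also have "(real k + 1) powr 1 * (real k + 1) powr e = (real k + 1) powr (2 + \<epsilon>) * (real k + 1) powr (2 + \<epsilon>)"
        unfolding powr_add[symmetric] by (simp add: e_def)
      also have "C * (2 ^ k * ((real k + 1) powr (2 + \<epsilon>) * (real k + 1) powr (2 + \<epsilon>))) = C * ?b\<^sup>2"
        by (simp add: power_mult_distrib power2_eq_square)
      finally have "sqrt ((real k + 1) * dyadic (\<lambda>t. block k t x) 0 k) \<le> sqrt (C * ?b\<^sup>2)" by simp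
      also have "\<dots> = sqrt C * ?b" by (simp add: real_sqrt_mult)
      finally have "sqrt ((real k + 1) * dyadic (\<lambda>t. block k t x) 0 k) \<le> sqrt C * ?b" .
      moreover have "C' \<le> C' * ?b"
      proof -
        have "1 * 1 \<le> ?b" using assms by (intro mult_mono ge_one_powr_ge_zero) auto
        thus ?thesis using C'0 mult_left_mono[of 1 ?b C'] by simp
      qed
      ultimately have "\<bar>discrepancy T x\<bar> \<le> sqrt C * ?b + C' * ?b"
        using discrepancy_bound[OF that, of x] C'[of k] by linarith
      thus ?thesis by (simp add: algebra_simps)
    qed
    thus ?case by blast
  qed
qed


section \<open>From hits to the counting function\<close>

lemma hits_periodic:
  assumes "c \<in> lattice" "q \<in> poly_vecs"
  shows "(\<lambda>k. c k + x k) \<in> hits q \<longleftrightarrow> x \<in> hits q"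
proof -
  have "dot (\<lambda>k. c k + x k) i q $$ n = dot x i q $$ n" if "n \<ge> 1" for i n
    using dot_lattice[OF assms, of i] that by (simp add: dot_add fls_polys_iff)
  thus ?thesis by (auto simp: hits_def cyl_def)
qed

lemma AE_discrepancy:
  assumes "\<epsilon> > 0"
  shows "AE x in M. \<exists>C. \<forall>k T. T \<le> 2 ^ k \<longrightarrow>
    \<bar>discrepancy T x\<bar> \<le> C * sqrt (2 ^ k) * (real k + 1) powr (2 + \<epsilon>)"
proof (rule AE_of_cube[OF _ AE_discrepancy_cube[OF assms]])
  fix x c :: "'m \<times> 'n \<Rightarrow> 'a fls" assume "c \<in> lattice"
  hence "discrepancy T (\<lambda>k. c k + x k) = discrepancy T x" for T
    unfolding discrepancy_def
    by (intro arg_cong2[of _ _ _ _ "(-)"] sum.cong refl)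
       (auto simp: indicator_def hits_periodic denoms_def)
  thus "\<exists>C. \<forall>k T. T \<le> 2 ^ k \<longrightarrow> \<bar>discrepancy T x\<bar> \<le> C * sqrt (2 ^ k) * (real k + 1) powr (2 + \<epsilon>)"
    if "\<exists>C. \<forall>k T. T \<le> 2 ^ k \<longrightarrow> \<bar>discrepancy T (\<lambda>k. c k + x k)\<bar>
      \<le> C * sqrt (2 ^ k) * (real k + 1) powr (2 + \<epsilon>)" using that by simp
qed

definition matrix_of :: "('m \<times> 'n \<Rightarrow> 'a fls) \<Rightarrow> 'a fls ^ 'n ^ 'm" where
  "matrix_of x = (\<chi> i j. x (i, j))"

lemma matrix_of_mult: "(matrix_of x *v q) $ i = dot x i q"
  by (simp add: matrix_of_def matrix_vector_mult_def dot_def)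

definition close :: "('m \<times> 'n \<Rightarrow> 'a fls) \<Rightarrow> 'a fls ^ 'm \<Rightarrow> 'a fls ^ 'n \<Rightarrow> bool" where
  "close x p q \<longleftrightarrow> p \<in> poly_vecs \<and> (\<forall>i. dot x i q - p $ i \<in> fls_ball (K q i))"

lemma approx_solutions_iff:
  "(p, q) \<in> approx_solutions a R T (matrix_of x) \<longleftrightarrow>
     q \<in> poly_vecs \<and> q \<noteq> 0 \<and> 0 \<le> size q \<and> size q \<le> real T \<and> close x p q"
proof (cases "q = 0")
  case True
  thus ?thesis by (simp add: approx_solutions_def norm_beta_0)
next
  case False
  have "Q powr R / norm_beta a q = Q powr (R - size q)"
    using norm_beta_eq[OF False] by (simp add: powr_diff)
  hence "norm_alpha a (matrix_of x *v q - p) < Q powr R / norm_beta a q \<longleftrightarrow>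
      (\<forall>i. dot x i q - p $ i \<in> fls_ball (K q i))"
    by (simp add: norm_alpha_less_iff matrix_of_mult K_def algebra_simps)
  moreover have "1 \<le> norm_beta a q \<longleftrightarrow> 0 \<le> size q"
    using Q_gt_1 powr_le_cancel_iff[of Q 0 "size q"] by (simp add: norm_beta_eq[OF False])
  moreover have "norm_beta a q \<le> Q ^ T \<longleftrightarrow> size q \<le> real T"
    using Q_gt_1 powr_le_cancel_iff[of Q "size q" "real T"]
    by (simp add: norm_beta_eq[OF False] powr_realpow)
  ultimately show ?thesis using False by (auto simp: approx_solutions_def close_def Q_def[symmetric])
qed

lemma finite_close: "finite {p. close x p q}"
proof -
  define b where "b i = min (K q i) (fls_subdegree (dot x i q) - 1)" for i
  have "{p. close x p q} \<subseteq> {p. \<forall>i. p $ i \<in> polys_below (nat (- b i))}"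
  proof clarify
    fix p i assume p: "close x p q"
    have "dot x i q - p $ i \<in> fls_ball (K q i)" using p by (simp add: close_def)
    hence d: "dot x i q - p $ i \<in> fls_ball (b i)" by (rule fls_ball_mono[rotated]) (simp add: b_def)
    have "dot x i q \<in> fls_ball (b i)" by (auto simp: fls_ball_iff b_def)
    from fls_ball_diff[OF this d] have "p $ i \<in> fls_ball (b i)" by (simp add: algebra_simps)
    hence "p $ i \<in> fls_ball (- int (nat (- b i)))" using p fls_polys_ball_0[of "p $ i"] 
      by (cases "b i \<ge> 0") (auto simp: close_def intro: fls_ball_mono)
    thus "p $ i \<in> polys_below (nat (- b i))" using p by (simp add: polys_below_def close_def)
  qed
  thus ?thesis by (rule finite_subset) (auto intro: finite_vec_set)
qed

text \<open>
  Two numerators of the same denominator differ by a polynomial of absolute value less than 1.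
\<close>

lemma close_unique:
  assumes "R < size q"
  shows "close x p q \<longleftrightarrow> x \<in> hits q \<and> p = (\<chi> i. poly_part (dot x i q))"
proof
  assume p: "close x p q"
  have "p $ i = poly_part (dot x i q)" for i
  proof -
    have d: "dot x i q - p $ i \<in> fls_ball 0"
      using p K_nonneg[OF assms, of i] by (auto simp: close_def intro: fls_ball_mono)
    have "p $ i - poly_part (dot x i q) \<in> fls_ball 0"
      using fls_ball_diff[OF minus_poly_part[of "dot x i q"] d] by simp
    moreover have "p $ i - poly_part (dot x i q) \<in> fls_polys"
      using p by (intro fls_polys_diff) (auto simp: close_def)
    ultimately show ?thesis using fls_polys_ball_0 by fastforce
  qed
  moreover have "x \<in> hits q"
    using p coeffs_vanish_iff unfolding hits_def cyl_def close_def by fast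
  ultimately show "x \<in> hits q \<and> p = (\<chi> i. poly_part (dot x i q))" by (simp add: vec_eq_iff)
next
  assume x: "x \<in> hits q \<and> p = (\<chi> i. poly_part (dot x i q))"
  have "dot x i q - poly_part (dot x i q) \<in> fls_ball (K q i)" for i
    using x by (auto simp: hits_def cyl_def fls_ball_def poly_part_nth)
  thus "close x p q" using x by (simp add: close_def)
qed

definition small_count :: "('m \<times> 'n \<Rightarrow> 'a fls) \<Rightarrow> nat" where
  "small_count x = card {(p, q). q \<in> poly_vecs \<and> q \<noteq> 0 \<and> 0 \<le> size q \<and> size q \<le> R \<and> close x p q}"

text \<open>
  The solutions with \<open>size q \<le> R\<close> do not depend on \<open>T\<close>; the others correspond to the denominators that are hit.
\<close>

lemma approx_count_eq:
  assumes "R \<le> real T"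
  shows "real (approx_count a R T (matrix_of x)) = real (small_count x) + main_term T + discrepancy T x"
proof -
  define A where "A = {(p, q). q \<in> poly_vecs \<and> q \<noteq> 0 \<and> 0 \<le> size q \<and> size q \<le> R \<and> close x p q}"
  define H where "H = {q \<in> denoms T. x \<in> hits q}"
  define B where "B = (\<lambda>q. (\<chi> i. poly_part (dot x i q), q)) ` H"
  have "A \<subseteq> (\<Union>q\<in>vecs_below (Suc T). {p. close x p q} \<times> {q})"
  proof clarify
    fix p q assume A: "(p, q) \<in> A"
    hence "size q < real (Suc T)" using assms by (auto simp: A_def)
    hence "q \<in> vecs_below (Suc T)" using A size_less_nat_iff[of q "Suc T"] by (auto simp: A_def)
    thus "(p, q) \<in> (\<Union>q\<in>vecs_below (Suc T). {p. close x p q} \<times> {q})" using A by (auto simp: A_def)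
  qed
  moreover have "finite (vecs_below (Suc T))" by (auto simp: vecs_below_def intro!: finite_vec_set)
  hence "finite (\<Union>q\<in>vecs_below (Suc T). {p. close x p q} \<times> {q})" by (auto simp: finite_close)
  ultimately have finA: "finite A" by (rule finite_subset)
  have finH: "finite H" by (simp add: H_def)
  have "approx_solutions a R T (matrix_of x) = A \<union> B"
  proof (intro set_eqI, clarify)
    fix p q
    show "(p, q) \<in> approx_solutions a R T (matrix_of x) \<longleftrightarrow> (p, q) \<in> A \<union> B"
    proof (cases "size q \<le> R")
      case True
      thus ?thesis using assms by (auto simp: approx_solutions_iff A_def B_def H_def denoms_def)
    next
      case False
      hence "R < size q" by simp
      thus ?thesis using R close_unique[of q x p]
        by (auto simp: approx_solutions_iff A_def B_def H_def denoms_def)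
    qed
  qed
  moreover have "A \<inter> B = {}" by (auto simp: A_def B_def H_def denoms_def)
  ultimately have "approx_count a R T (matrix_of x) = card A + card B"
    using finA finH by (simp add: approx_count_def B_def card_Un_disjoint)
  also have "card B = card H" unfolding B_def by (intro card_image) (auto simp: inj_on_def)
  finally have "real (approx_count a R T (matrix_of x)) = real (small_count x) + real (card H)"
    by (simp add: small_count_def A_def)
  also have "real (card H) = (\<Sum>q\<in>denoms T. indicator (hits q) x)"
  proof -
    have "real (card H) = (\<Sum>q\<in>H. 1)" by simp
    also have "\<dots> = (\<Sum>q\<in>denoms T. if x \<in> hits q then 1 else 0)"
      unfolding H_def by (rule sum.inter_filter) simp
    also have "\<dots> = (\<Sum>q\<in>denoms T. indicator (hits q) x)" by (intro sum.cong) (auto simp: indicator_def)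
    finally show ?thesis .
  qed
  finally show ?thesis by (simp add: discrepancy_def)
qed

text \<open>
  The constant 8 and the argument \<open>T / 2\<close> of the logarithm match the lower bound \<open>T / 2 \<le> \<Psi>(T)\<close> for large \<open>T\<close>.
\<close>

lemma dyadic_scale:
  fixes T :: nat
  assumes "T \<ge> 4"
  obtains k where "T \<le> 2 ^ k" "2 ^ k \<le> 2 * real T" "real k + 1 \<le> 8 * ln (real T / 2)"
proof -
  define k where "k = nat \<lceil>log 2 (real T)\<rceil>"
  have l: "0 \<le> log 2 (real T)" using assms by simp
  have k: "log 2 (real T) \<le> real k" "real k \<le> log 2 (real T) + 1" using l unfolding k_def by linarith+
  have "real T = 2 powr log 2 (real T)" using assms by simp
  also have "\<dots> \<le> 2 powr real k" using k by simp
  also have "\<dots> = real (2 ^ k)" by (simp add: powr_realpow)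
  finally have 1: "T \<le> 2 ^ k" by (simp only: of_nat_le_iff)
  have "2 ^ k = 2 powr real k" by (simp add: powr_realpow)
  also have "\<dots> \<le> 2 powr (log 2 (real T) + 1)" using k by simp
  also have "\<dots> = 2 * real T" using assms by (simp add: powr_add)
  finally have 2: "2 ^ k \<le> 2 * real T" .
  have ln2: "2 / 3 \<le> ln (2 :: real)" by (rule ln2_ge_two_thirds)
  have "ln 2 \<le> ln (real T / 2)" using assms by simp
  hence T2: "2 / 3 \<le> ln (real T / 2)" using ln2 by linarith
  have "log 2 (real T) = log 2 (real T / 2) + 1" using assms by (simp add: log_divide)
  also have "log 2 (real T / 2) = ln (real T / 2) / ln 2" by (simp add: log_def)
  also have "\<dots> \<le> ln (real T / 2) / (2 / 3)" using T2 ln2 by (intro divide_left_mono) auto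
  finally have "log 2 (real T) \<le> 3 / 2 * ln (real T / 2) + 1" by simp
  hence 3: "real k + 1 \<le> 8 * ln (real T / 2)" using k T2 by linarith
  show thesis by (rule that[OF 1 2 3])
qed

lemma AE_approx_count:
  assumes "\<epsilon> > 0"
  shows "AE x in M. (\<lambda>T. real (approx_count a R T (matrix_of x)) - main_term T)
    \<in> O(\<lambda>T. main_term T powr (1 / 2) * ln (main_term T) powr (2 + \<epsilon>))"
  using AE_discrepancy[OF assms]
proof eventually_elim
  case (elim x)
  then obtain C where C: "\<And>k T. T \<le> 2 ^ k \<Longrightarrow>
    \<bar>discrepancy T x\<bar> \<le> C * sqrt (2 ^ k) * (real k + 1) powr (2 + \<epsilon>)" by blast
  have C0: "0 \<le> C" using C[of 0 0] by simp
  define c where "c = real (small_count x) + C * 2 * 8 powr (2 + \<epsilon>)"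
  have "\<bar>real (approx_count a R T (matrix_of x)) - main_term T\<bar>
      \<le> c * (main_term T powr (1 / 2) * ln (main_term T) powr (2 + \<epsilon>))"
    if T: "T \<ge> 6" "real T \<ge> 2 * R + 2" for T
  proof -
    define S where "S = main_term T"
    have S: "real T / 2 \<le> S" using main_term_lower[of T] T unfolding S_def by linarith
    hence S3: "3 \<le> S" using T by linarith
    have lnS: "1 \<le> ln S"
    proof -
      have "exp 1 \<le> S" using exp_le S3 by linarith
      hence "ln (exp 1) \<le> ln S" by (subst ln_le_cancel_iff) (use S3 in auto)
      thus ?thesis by simp
    qed
    let ?r = "S powr (1 / 2) * ln S powr (2 + \<epsilon>)"
    have r1: "1 \<le> ?r"
    proof -
      have "1 * 1 \<le> ?r" using S3 lnS assms by (intro mult_mono ge_one_powr_ge_zero) auto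
      thus ?thesis by simp
    qed
    have "T \<ge> 4" using T by simp
    then obtain k where k: "T \<le> 2 ^ k" "2 ^ k \<le> 2 * real T" "real k + 1 \<le> 8 * ln (real T / 2)"
      by (rule dyadic_scale)
    have "sqrt (2 ^ k) \<le> sqrt (2\<^sup>2 * S)" using k S by (intro real_sqrt_le_mono) simp
    also have "\<dots> = 2 * S powr (1 / 2)" using S3 by (simp add: real_sqrt_mult powr_half_sqrt)
    finally have b1: "sqrt (2 ^ k) \<le> 2 * S powr (1 / 2)" .
    have "ln (real T / 2) \<le> ln S" using S T by (subst ln_le_cancel_iff) auto
    hence "(real k + 1) powr (2 + \<epsilon>) \<le> (8 * ln S) powr (2 + \<epsilon>)"
      using k assms by (intro powr_mono2) auto
    also have "\<dots> = 8 powr (2 + \<epsilon>) * ln S powr (2 + \<epsilon>)" using lnS by (simp add: powr_mult)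
    finally have b2: "(real k + 1) powr (2 + \<epsilon>) \<le> 8 powr (2 + \<epsilon>) * ln S powr (2 + \<epsilon>)" .
    have "\<bar>discrepancy T x\<bar> \<le> C * sqrt (2 ^ k) * (real k + 1) powr (2 + \<epsilon>)" by (rule C[OF k(1)])
    also have "\<dots> \<le> C * (2 * S powr (1 / 2)) * (8 powr (2 + \<epsilon>) * ln S powr (2 + \<epsilon>))"
      using C0 b1 b2 by (intro mult_mono mult_nonneg_nonneg) auto
    also have "\<dots> = C * 2 * 8 powr (2 + \<epsilon>) * ?r" by (simp add: mult_ac)
    finally have d: "\<bar>discrepancy T x\<bar> \<le> C * 2 * 8 powr (2 + \<epsilon>) * ?r" .
    have s: "real (small_count x) \<le> real (small_count x) * ?r"
      using mult_left_mono[OF r1, of "real (small_count x)"] by simp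
    have "R \<le> real T" using T R by linarith
    hence "\<bar>real (approx_count a R T (matrix_of x)) - S\<bar> \<le> real (small_count x) + \<bar>discrepancy T x\<bar>"
      by (simp add: approx_count_eq S_def)
    also have "\<dots> \<le> c * ?r" using d s by (simp add: c_def distrib_right)
    finally show ?thesis by (simp add: S_def)
  qed
  moreover have "eventually (\<lambda>T. T \<ge> 6 \<and> real T \<ge> 2 * R + 2) sequentially"
    by (intro eventually_conj eventually_ge_at_top eventually_compose_filterlim[OF _ filterlim_real_sequentially])
  ultimately show ?case
    by (intro bigoI[of _ c]) (auto elim!: eventually_mono simp: abs_mult)
qed

end

theorem proposition1p2:
  fixes lam :: "'a::{field,finite} fls measure"
    and a :: "'m::finite + 'n::finite \<Rightarrow> nat"
    and R :: real
  assumes "haar_measure lam"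
    and "a \<in> weights"
    and "R > 0"
  shows "\<exists>\<Psi> :: nat \<Rightarrow> real. \<forall>\<epsilon>>0.
    AE A in PiM (UNIV :: ('m \<times> 'n) set) (\<lambda>_. lam).
      (\<lambda>T. real (approx_count a R T (\<chi> i j. A (i, j))) - \<Psi> T)
        \<in> O(\<lambda>T. \<Psi> T powr (1 / 2) * ln (\<Psi> T) powr (2 + \<epsilon>))"
proof -
  interpret weighted_approximation lam "TYPE('m \<times> 'n)" a R "real CARD('a)"
    by unfold_locales (use assms in auto)
  show ?thesis
    using AE_approx_count unfolding M_def matrix_of_def by (intro exI[of _ main_term]) blast
qed

end
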